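(* Let $s,p\geq 1$ be integers and let $n\geq 2(p+s)$ be an integer. Then the family $\mathcal{H}^{(p,s)}(n)$ is EKR. Moreover, if $n>2(p+s)$, then $\mathcal{H}^{(p,s)}(n)$ is strongly EKR.
   Context: For a finite set $X$, a family $\mathcal{G}\subseteq 2^X$ and $x\in X$, let $\mathcal{G}_x=\{G\in\mathcal{G}: x\in G\}$; it is called the star in $\mathcal{G}$ centered at $x$. A family $\mathcal{F}$ of sets is intersecting if $F\cap G\neq\emptyset$ for all $F,G\in\mathcal{F}$. A family $\mathcal{G}\subseteq 2^X$ is EKR if there exists $x\in X$ such that $|\mathcal{F}|\leq|\mathcal{G}_x|$ for every intersecting subfamily $\mathcal{F}\subseteq\mathcal{G}$. It is strongly EKR if every maximum-size intersecting subfamily of $\mathcal{G}$ is a star in $\mathcal{G}$. The perfect matching graph $M_n$ is the graph consisting of $n$ pairwise disjoint edges $e_1,\ldots,e_n$, with $e_i=\{l_i,r_i\}$; its vertex set is $V(M_n)=\{l_1,\ldots,l_n\}\cup\{r_1,\ldots,r_n\}$ ($2n$ vertices). For $p,s\ge 0$ with $2p+s\geq 1$, $\mathcal{H}^{(p,s)}(n)\subseteq 2^{V(M_n)}$ is the family of vertex sets of all induced subgraphs of $M_n$ consisting of exactly $p$ disjoint edges and $s$ isolated vertices. Equivalently, it consists of all $(2p+s)$-element sets $H\subseteq V(M_n)$ that contain both endpoints of exactly $p$ of the edges $e_1,\dots,e_n$, exactly one endpoint of exactly $s$ of the edges, and no endpoint of the remaining $n-p-s$ edges. Here the ground set is $X=V(M_n)$.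 *)

theory Defs
  imports "HOL-Library.Disjoint_Sets"
begin

subsection \<open>Intersecting families, stars and the EKR properties\<close>

text \<open>The case \<open>A = B\<close> is included, so an intersecting family does not contain the empty set.\<close>

definition intersecting_family :: "'a set set \<Rightarrow> bool" where
  "intersecting_family \<F> \<longleftrightarrow> (\<forall>A\<in>\<F>. \<forall>B\<in>\<F>. A \<inter> B \<noteq> {})"

definition star :: "'a set set \<Rightarrow> 'a \<Rightarrow> 'a set set" where
  "star \<G> x = {G \<in> \<G>. x \<in> G}"

text \<open>The next three notions are meant for a finite ground set \<open>X\<close> and \<open>\<G> \<subseteq> Pow X\<close>, so that
  \<open>card\<close> is the true cardinality throughout.\<close>

definition EKR :: "'a set \<Rightarrow> 'a set set \<Rightarrow> bool" where
  "EKR X \<G> \<longleftrightarrow>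
     (\<exists>x\<in>X. \<forall>\<F>. \<F> \<subseteq> \<G> \<and> intersecting_family \<F> \<longrightarrow> card \<F> \<le> card (star \<G> x))"

definition max_intersecting_subfamily :: "'a set set \<Rightarrow> 'a set set \<Rightarrow> bool" where
  "max_intersecting_subfamily \<G> \<F> \<longleftrightarrow>
     \<F> \<subseteq> \<G> \<and> intersecting_family \<F> \<and>
     (\<forall>\<F>'. \<F>' \<subseteq> \<G> \<and> intersecting_family \<F>' \<longrightarrow> card \<F>' \<le> card \<F>)"

definition strongly_EKR :: "'a set \<Rightarrow> 'a set set \<Rightarrow> bool" where
  "strongly_EKR X \<G> \<longleftrightarrow> (\<forall>\<F>. max_intersecting_subfamily \<G> \<F> \<longrightarrow> (\<exists>x\<in>X. \<F> = star \<G> x))"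

subsection \<open>The perfect matching graph and its induced subgraphs\<close>

datatype vertex = Lvert nat | Rvert nat

definition M_edge :: "nat \<Rightarrow> vertex set" where
  "M_edge i = {Lvert i, Rvert i}"

definition M_verts :: "nat \<Rightarrow> vertex set" where
  "M_verts n = Lvert ` {1..n} \<union> Rvert ` {1..n}"

definition M_edges :: "nat \<Rightarrow> vertex set set" where
  "M_edges n = M_edge ` {1..n}"

definition induced_edges :: "'a set set \<Rightarrow> 'a set \<Rightarrow> 'a set set" where
  "induced_edges E H = {e \<in> E. e \<subseteq> H}"

text \<open>The graph with vertex set \<open>V\<close> and edge set \<open>E\<close> consists of exactly \<open>p\<close> disjoint edges and
  \<open>s\<close> isolated vertices; finiteness rules out the junk value \<open>card = 0\<close> on infinite sets.\<close>

definition disjoint_edges_and_isolated :: "'a set \<Rightarrow> 'a set set \<Rightarrow> nat \<Rightarrow> nat \<Rightarrow> bool" where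
  "disjoint_edges_and_isolated V E p s \<longleftrightarrow>
     finite V \<and> (\<forall>e\<in>E. e \<subseteq> V \<and> card e = 2) \<and> disjoint E \<and> card E = p \<and> card (V - \<Union>E) = s"

definition H_family :: "nat \<Rightarrow> nat \<Rightarrow> nat \<Rightarrow> vertex set set" where
  "H_family p s n =
     {H. H \<subseteq> M_verts n \<and> disjoint_edges_and_isolated H (induced_edges (M_edges n) H) p s}"

subsection \<open>Basic facts\<close>

lemma finite_M_verts: "finite (M_verts n)"
  by (simp add: M_verts_def)

lemma card_M_verts: "card (M_verts n) = 2 * n"
proof -
  have "Lvert ` {1..n} \<inter> Rvert ` {1..n} = {}"
    by auto
  then show ?thesis
    unfolding M_verts_def by (subst card_Un_disjoint) (simp_all add: card_image inj_on_def)
qed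

lemma H_family_subset: "H_family p s n \<subseteq> Pow (M_verts n)"
  by (auto simp: H_family_def)

lemma finite_H_family: "finite (H_family p s n)"
  using H_family_subset finite_M_verts by (metis finite_Pow_iff finite_subset)

text \<open>The description of the family by the number of edges met in two points and in one point.\<close>

lemma mem_H_family_iff:
  "H \<in> H_family p s n \<longleftrightarrow>
     H \<subseteq> M_verts n \<and>
     card {i \<in> {1..n}. card (M_edge i \<inter> H) = 2} = p \<and>
     card {i \<in> {1..n}. card (M_edge i \<inter> H) = 1} = s"
proof (cases "H \<subseteq> M_verts n")
  case True
  let ?E = "induced_edges (M_edges n) H"
  have int: "M_edge i \<inter> H =
      (if Lvert i \<in> H then {Lvert i} else {}) \<union> (if Rvert i \<in> H then {Rvert i} else {})" for i
    by (auto simp: M_edge_def)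
  have two: "card (M_edge i \<inter> H) = 2 \<longleftrightarrow> M_edge i \<subseteq> H" for i
    unfolding int by (auto simp: M_edge_def)
  have one: "card (M_edge i \<inter> H) = 1 \<longleftrightarrow> (Lvert i \<in> H) \<noteq> (Rvert i \<in> H)" for i
    unfolding int by auto
  have fin: "finite H"
    using True finite_M_verts finite_subset by blast
  have E: "?E = M_edge ` {i \<in> {1..n}. M_edge i \<subseteq> H}"
    by (auto simp: induced_edges_def M_edges_def)
  have inj: "inj M_edge"
    by (auto simp: inj_def M_edge_def doubleton_eq_iff)
  have cardE: "card ?E = card {i \<in> {1..n}. card (M_edge i \<inter> H) = 2}"
    unfolding E two by (rule card_image) (meson inj inj_on_subset subset_UNIV)
  have disj: "disjoint ?E"
    unfolding E by (auto simp: disjoint_def M_edge_def)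
  have e2: "\<forall>e\<in>?E. e \<subseteq> H \<and> card e = 2"
    unfolding E by (auto simp: M_edge_def)
  let ?g = "\<lambda>v. case v of Lvert i \<Rightarrow> i | Rvert i \<Rightarrow> i"
  have iso: "v \<in> H - \<Union>?E \<longleftrightarrow>
      (\<exists>i\<in>{1..n}. v \<in> H \<and> v \<in> M_edge i \<and> (Lvert i \<in> H) \<noteq> (Rvert i \<in> H))" for v
    using True unfolding E M_verts_def by (cases v) (auto simp: M_edge_def)
  have "bij_betw ?g (H - \<Union>?E) {i \<in> {1..n}. card (M_edge i \<inter> H) = 1}"
    unfolding one
  proof (rule bij_betw_imageI)
    show "inj_on ?g (H - \<Union>?E)"
    proof (rule inj_onI)
      fix v w assume v: "v \<in> H - \<Union>?E" and w: "w \<in> H - \<Union>?E" and eq: "?g v = ?g w"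
      have "(Lvert i \<in> H) \<noteq> (Rvert i \<in> H)" if "v \<in> M_edge i" for i
        using v that unfolding iso by (auto simp: M_edge_def)
      then have "\<not> (Lvert (?g v) \<in> H \<and> Rvert (?g v) \<in> H)"
        by (cases v) (auto simp: M_edge_def)
      then show "v = w"
        using v w eq by (cases v; cases w) auto
    qed
    have "i \<in> ?g ` (H - \<Union>?E)" if "i \<in> {1..n}" "(Lvert i \<in> H) \<noteq> (Rvert i \<in> H)" for i
    proof (cases "Lvert i \<in> H")
      case True
      then have "Lvert i \<in> H - \<Union>?E" unfolding iso using that by (auto simp: M_edge_def)
      then show ?thesis by (rule rev_image_eqI) simp
    next
      case False
      then have "Rvert i \<in> H - \<Union>?E" unfolding iso using that by (auto simp: M_edge_def)
      then show ?thesis by (rule rev_image_eqI) simp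
    qed
    moreover have "?g v \<in> {1..n} \<and> (Lvert (?g v) \<in> H) \<noteq> (Rvert (?g v) \<in> H)"
      if "v \<in> H - \<Union>?E" for v
      using that unfolding iso by (auto simp: M_edge_def)
    ultimately show "?g ` (H - \<Union>?E) = {i \<in> {1..n}. (Lvert i \<in> H) \<noteq> (Rvert i \<in> H)}"
      by blast
  qed
  then have "card (H - \<Union>?E) = card {i \<in> {1..n}. card (M_edge i \<inter> H) = 1}"
    by (rule bij_betw_same_card)
  then show ?thesis
    using True fin e2 disj cardE
    unfolding H_family_def disjoint_edges_and_isolated_def mem_Collect_eq by metis
qed (simp add: H_family_def)

end

theory Submission
  imports Defs "HOL-Combinatorics.Permutations"
begin

text \<open>
  Katona's cycle method.  Put the \<open>n\<close> edges on a cycle and take the \<open>2n\<close> sets \<open>A\<^sub>i\<close> (\<open>p\<close> full edges from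
  position \<open>i\<close> on, followed by \<open>s\<close> left vertices) and \<open>B\<^sub>i\<close> (\<open>s\<close> right vertices followed by \<open>p\<close> full
  edges).  As \<open>A\<^sub>i\<close> and \<open>B\<^sub>j\<close> are disjoint whenever \<open>j - i\<close> lies in \<open>[p, n - p - s]\<close> modulo \<open>n\<close>, and the
  sum of a cyclic set \<open>I\<close> with an interval of \<open>t + 1\<close> elements has at least \<open>min n (|I| + t)\<close> elements,
  an intersecting family contains at most \<open>2p + s\<close> of these sets, while a star contains exactly
  \<open>2p + s\<close>.  Averaging over the automorphism group, which is transitive on the family, gives the
  bound.

  If \<open>n > 2(p + s)\<close> and equality holds, every image of the cycle is tight.  Then the indices of the
  \<open>A\<^sub>i\<close> in the family form an interval, and its right end determines an edge \<open>e\<close> together with sets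
  \<open>A\<^sub>i\<close>, \<open>B\<^sub>j\<close> in the family meeting exactly in \<open>e\<close>.  This situation is preserved by enough swaps of
  edges to generate the stabiliser of \<open>e\<close>, so all sets containing \<open>e\<close> are in the family and every
  member meets \<open>e\<close>.  Tightness now forces one of two disjoint sets containing opposite end points of
  \<open>e\<close> into the family, and the same generation argument yields the full star of one end point.
\<close>

section \<open>Cyclic interval counting\<close>

text \<open>Subsets of the integers modulo \<open>n\<close> are encoded as \<open>n\<close>-periodic
  predicates on \<open>int\<close>, so that shifts and reflections become substitutions in the
  argument; sizes are taken on the representatives \<open>0..<n\<close>.\<close>

definition cnt :: "int \<Rightarrow> (int \<Rightarrow> bool) \<Rightarrow> nat" where
  "cnt n A = card {i \<in> {0..<n}. A i}"

lemma finite_int_segment [simp]: "finite {i::int. 0 \<le> i \<and> i < n \<and> A i}"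
  by (rule finite_subset[of _ "{0..<n}"]) auto

lemma finite_cnt_set: "finite {i \<in> {0..<n::int}. A i}"
  by simp

definition periodic :: "int \<Rightarrow> (int \<Rightarrow> bool) \<Rightarrow> bool" where
  "periodic n A \<longleftrightarrow> (\<forall>i. A (i + n) = A i)"

lemma periodic_mult:
  assumes "periodic n A"
  shows "A (i + c * n) = A i"
proof (induction c rule: int_induct[where k = 0])
  case (step1 c)
  have "A (i + (c + 1) * n) = A ((i + c * n) + n)"
    by (simp add: algebra_simps)
  then show ?case using assms step1 by (simp add: periodic_def)
next
  case (step2 c)
  have "A (i + c * n) = A ((i + (c - 1) * n) + n)"
    by (simp add: algebra_simps)
  then show ?case using assms step2 by (simp add: periodic_def)
qed simp

lemma periodic_cong:
  assumes "periodic n A" and "i mod n = j mod n"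
  shows "A i = A j"
proof -
  have "A (i mod n + (i div n) * n) = A (j mod n + (j div n) * n)"
    unfolding periodic_mult[OF assms(1)] using assms(2) by simp
  then show ?thesis by simp
qed

lemma periodic_mod:
  assumes "periodic n A"
  shows "A (i mod n) = A i"
  by (rule periodic_cong[OF assms]) simp

lemma periodic_shift:
  assumes "periodic n A"
  shows "periodic n (\<lambda>i. A (i + c))"
proof -
  have "A (i + n + c) = A (i + c)" for i
    by (rule periodic_cong[OF assms]) (simp add: mod_eq_dvd_iff)
  then show ?thesis by (simp add: periodic_def)
qed

lemma periodic_uminus:
  assumes "periodic n A"
  shows "periodic n (\<lambda>i. A (- i))"
proof -
  have "A (- (i + n)) = A (- i)" for i
    by (rule periodic_cong[OF assms]) (simp add: mod_eq_dvd_iff)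
  then show ?thesis by (simp add: periodic_def)
qed

lemma cnt_le: "n > 0 \<Longrightarrow> cnt n A \<le> nat n"
  unfolding cnt_def by (rule order_trans[OF card_mono[of "{0..<n}"]]) auto

lemma cnt_pos:
  assumes "n > 0" and "periodic n A" and "A i"
  shows "cnt n A > 0"
proof -
  have "A (i mod n)" using periodic_mod[OF assms(2)] assms(3) by blast
  then have "i mod n \<in> {i \<in> {0..<n}. A i}" using assms(1) by simp
  then show ?thesis unfolding cnt_def card_gt_0_iff using finite_cnt_set by blast
qed

lemma cnt_full:
  assumes "n > 0" and "periodic n A" and "cnt n A \<ge> nat n"
  shows "A i"
proof -
  have "{i \<in> {0..<n}. A i} = {0..<n}"
    by (rule card_seteq) (use assms(3) in \<open>auto simp: cnt_def\<close>)
  moreover have "i mod n \<in> {0..<n}" using assms(1) by simp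
  ultimately have "A (i mod n)" by blast
  then show ?thesis using periodic_mod[OF assms(2)] by blast
qed

lemma cnt_disjoint:
  assumes "\<And>i. \<not> (A i \<and> B i)"
  shows "cnt n A + cnt n B = cnt n (\<lambda>i. A i \<or> B i)"
proof -
  have "{i \<in> {0..<n}. A i \<or> B i} = {i \<in> {0..<n}. A i} \<union> {i \<in> {0..<n}. B i}" by auto
  moreover have "card ({i \<in> {0..<n}. A i} \<union> {i \<in> {0..<n}. B i}) =
      card {i \<in> {0..<n}. A i} + card {i \<in> {0..<n}. B i}"
    by (rule card_Un_disjoint) (use assms in auto)
  ultimately show ?thesis unfolding cnt_def by simp
qed

lemma cnt_reindex:
  assumes "n > 0" and "periodic n A" and "inj_on (\<lambda>i. h i mod n) {0..<n}"
  shows "cnt n (\<lambda>i. A (h i)) = cnt n A"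
proof -
  have im: "(\<lambda>i. h i mod n) ` {0..<n} = {0..<n}"
    by (rule endo_inj_surj) (use assms(1,3) in auto)
  have eq: "A (h i mod n) = A (h i)" for i
    by (rule periodic_mod[OF assms(2)])
  have "bij_betw (\<lambda>i. h i mod n) {i \<in> {0..<n}. A (h i)} {i \<in> {0..<n}. A i}"
    unfolding bij_betw_def
  proof
    show "inj_on (\<lambda>i. h i mod n) {i \<in> {0..<n}. A (h i)}"
      using assms(3) by (rule inj_on_subset) auto
    show "(\<lambda>i. h i mod n) ` {i \<in> {0..<n}. A (h i)} = {i \<in> {0..<n}. A i}"
    proof (intro equalityI subsetI)
      fix j assume j: "j \<in> {i \<in> {0..<n}. A i}"
      then obtain i where "i \<in> {0..<n}" "j = h i mod n" using im by blast
      then show "j \<in> (\<lambda>i. h i mod n) ` {i \<in> {0..<n}. A (h i)}" using j eq by blast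
    next
      fix j assume "j \<in> (\<lambda>i. h i mod n) ` {i \<in> {0..<n}. A (h i)}"
      then show "j \<in> {i \<in> {0..<n}. A i}" using im eq by blast
    qed
  qed
  then show ?thesis unfolding cnt_def by (rule bij_betw_same_card)
qed

lemma cnt_shift:
  assumes "n > 0" and "periodic n A"
  shows "cnt n (\<lambda>i. A (i + c)) = cnt n A"
proof (rule cnt_reindex[OF assms], rule inj_onI)
  fix i j assume ij: "i \<in> {0..<n}" "j \<in> {0..<n}" and "(i + c) mod n = (j + c) mod n"
  then have "i mod n = j mod n" by (simp only: mod_eq_dvd_iff) simp
  then show "i = j" using ij by simp
qed

lemma cnt_reflect:
  assumes "n > 0" and "periodic n A"
  shows "cnt n (\<lambda>i. A (- i)) = cnt n A"
proof (rule cnt_reindex[OF assms], rule inj_onI)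
  fix i j assume ij: "i \<in> {0..<n}" "j \<in> {0..<n}" and "(- i) mod n = (- j) mod n"
  then have "j mod n = i mod n" by (simp only: mod_eq_dvd_iff) simp
  then show "i = j" using ij by simp
qed

text \<open>Without a right end the set would be closed under successor and, starting from
  \<open>i\<close>, would reach every residue, that of \<open>j\<close> included.\<close>

lemma boundary_exists:
  assumes "n > 0" and "periodic n A" and "A i" and "\<not> A j"
  obtains b where "A b" and "\<not> A (b + 1)"
proof (rule ccontr)
  assume "\<not> thesis"
  then have step: "A b \<Longrightarrow> A (b + 1)" for b using that by blast
  have up: "A (i + int m)" for m
  proof (induction m)
    case (Suc m)
    then show ?case using step[of "i + int m"] by (simp add: algebra_simps)
  qed (simp add: assms(3))
  let ?d = "(j - i) mod n"
  have "A (i + int (nat ?d))" by (rule up)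
  moreover have "(i + int (nat ?d)) mod n = j mod n"
    using assms(1) by (simp add: mod_simps)
  ultimately show False using assms(4) periodic_cong[OF assms(2)] by blast
qed

section \<open>Sumsets of a cyclic set with the interval from 0 to t\<close>

definition spread :: "nat \<Rightarrow> (int \<Rightarrow> bool) \<Rightarrow> int \<Rightarrow> bool" where
  "spread t A z \<longleftrightarrow> (\<exists>u\<in>{0..int t}. A (z - u))"

lemma spread_0 [simp]: "spread 0 A = A"
  by (auto simp: spread_def fun_eq_iff)

lemma spread_Suc: "spread (Suc t) A z \<longleftrightarrow> spread t A z \<or> spread t A (z - 1)"
proof
  assume "spread (Suc t) A z"
  then obtain u where u: "u \<in> {0..int (Suc t)}" "A (z - u)" unfolding spread_def by blast
  show "spread t A z \<or> spread t A (z - 1)"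
  proof (cases "u \<le> int t")
    case True
    then show ?thesis using u unfolding spread_def by auto
  next
    case False
    then have "u - 1 \<in> {0..int t}" "A (z - 1 - (u - 1))" using u by auto
    then show ?thesis unfolding spread_def by blast
  qed
next
  assume "spread t A z \<or> spread t A (z - 1)"
  then show "spread (Suc t) A z"
  proof
    assume "spread t A (z - 1)"
    then obtain u where "u \<in> {0..int t}" "A (z - 1 - u)" unfolding spread_def by blast
    then have "u + 1 \<in> {0..int (Suc t)}" "A (z - (u + 1))" by (auto simp: algebra_simps)
    then show ?thesis unfolding spread_def by blast
  qed (force simp: spread_def)
qed

lemma spread_spread: "spread (Suc t) A = spread t (spread 1 A)"
proof (induction t)
  case (Suc t)
  show ?case by (rule ext) (simp only: spread_Suc[of "Suc t"] spread_Suc[of t "spread 1 A"] Suc)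
qed simp

lemma periodic_spread: "periodic n A \<Longrightarrow> periodic n (spread t A)"
proof -
  assume per: "periodic n A"
  have "A (i + n - u) = A (i - u)" for i u
    by (rule periodic_cong[OF per]) (simp add: mod_eq_dvd_iff)
  then show ?thesis by (simp add: periodic_def spread_def)
qed

text \<open>As long as the cycle is not covered, the sumset has a right end, and lengthening the
  interval by one adds the successor of that end. This is the interval case of a Cauchy-Davenport
  bound, valid for every modulus.\<close>

lemma cnt_spread:
  assumes "n > 0" and "periodic n A" and "A i"
  shows "min (nat n) (cnt n A + t) \<le> cnt n (spread t A)"
proof (induction t)
  case (Suc t)
  let ?D = "spread t A"
  have per: "periodic n ?D" by (rule periodic_spread[OF assms(2)])
  have "?D i" using assms(3) unfolding spread_def by force
  show ?case
  proof (cases "\<forall>j. ?D j")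
    case True
    then have "{i \<in> {0..<n}. spread (Suc t) A i} = {0..<n}" by (auto simp: spread_Suc)
    then show ?thesis unfolding cnt_def by simp
  next
    case False
    then obtain b where b: "?D b" "\<not> ?D (b + 1)"
      using boundary_exists[OF assms(1) per \<open>?D i\<close>] by blast
    let ?c = "(b + 1) mod n"
    have c: "\<not> ?D ?c" "?D (?c - 1)"
    proof -
      have "?D ?c = ?D (b + 1)" "?D (?c - 1) = ?D b"
        by (rule periodic_cong[OF per], simp add: mod_simps)+
      then show "\<not> ?D ?c" "?D (?c - 1)" using b by blast+
    qed
    have "insert ?c {i \<in> {0..<n}. ?D i} \<subseteq> {i \<in> {0..<n}. spread (Suc t) A i}"
      using c assms(1) by (auto simp: spread_Suc)
    then have "card (insert ?c {i \<in> {0..<n}. ?D i}) \<le> cnt n (spread (Suc t) A)"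
      unfolding cnt_def by (intro card_mono) auto
    then have "Suc (cnt n ?D) \<le> cnt n (spread (Suc t) A)"
      using c unfolding cnt_def by simp
    then show ?thesis using Suc by linarith
  qed
qed simp

text \<open>Two different right ends gain two elements already in the first unit step, one more than
  \<open>cnt_spread\<close> guarantees. This surplus makes the right end unique in the tight
  case.\<close>

lemma cnt_spread_two_ends:
  assumes "n > 0" and "periodic n A"
    and "A a" "\<not> A (a + 1)" "A b" "\<not> A (b + 1)" "a mod n \<noteq> b mod n"
  shows "min (nat n) (cnt n A + t + 2) \<le> cnt n (spread (Suc t) A)"
proof -
  let ?D = "spread 1 A"
  have D: "?D z \<longleftrightarrow> A z \<or> A (z - 1)" for z using spread_Suc[of 0 A z] by simp
  have "?D a" using assms(3) by (simp add: D del: One_nat_def)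
  let ?a = "(a + 1) mod n" and ?b = "(b + 1) mod n"
  have ab: "\<not> A ?a" "A (?a - 1)" "\<not> A ?b" "A (?b - 1)"
  proof -
    have "A ?a = A (a + 1)" "A (?a - 1) = A a" "A ?b = A (b + 1)" "A (?b - 1) = A b"
      by (rule periodic_cong[OF assms(2)], simp add: mod_simps)+
    then show "\<not> A ?a" "A (?a - 1)" "\<not> A ?b" "A (?b - 1)" using assms(3-6) by blast+
  qed
  have "?a \<noteq> ?b"
    using assms(7) by (metis add_diff_cancel_right' mod_diff_left_eq)
  have "{?a, ?b} \<union> {i \<in> {0..<n}. A i} \<subseteq> {i \<in> {0..<n}. ?D i}"
    using ab assms(1) by (auto simp: D simp del: One_nat_def)
  then have "card ({?a, ?b} \<union> {i \<in> {0..<n}. A i}) \<le> cnt n ?D"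
    unfolding cnt_def by (intro card_mono) auto
  then have "cnt n A + 2 \<le> cnt n ?D"
    using ab \<open>?a \<noteq> ?b\<close> unfolding cnt_def by simp
  moreover have "min (nat n) (cnt n ?D + t) \<le> cnt n (spread t ?D)"
    by (rule cnt_spread[OF assms(1) periodic_spread[OF assms(2)] \<open>?D a\<close>])
  ultimately show ?thesis unfolding spread_spread by linarith
qed

section \<open>Pairs of cyclic sets avoiding intervals of differences\<close>

text \<open>Abstracts the index sets of an intersecting family on the two systems of arcs:
  \<open>k\<close> will be \<open>p + s\<close>, the number of edges an arc meets, and the excluded
  differences are those at which two arcs are disjoint.\<close>

locale cyclic_pair =
  fixes n p k :: int and A B :: "int \<Rightarrow> bool"
  assumes p: "0 < p" "p < k" and n: "2 * k \<le> n"
    and perA: "periodic n A" and perB: "periodic n B"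
    and cross: "A i \<Longrightarrow> B j \<Longrightarrow> (j - i) mod n \<notin> {p..n - k}"
    and selfA: "A i \<Longrightarrow> A j \<Longrightarrow> (j - i) mod n \<notin> {k..n - k}"
    and selfB: "B i \<Longrightarrow> B j \<Longrightarrow> (j - i) mod n \<notin> {k..n - k}"
begin

lemma n0: "n > 0" using p n by linarith

text \<open>The sumset of \<open>C\<close> with the interval from \<open>q\<close> to
  \<open>n - k\<close> misses \<open>D\<close>, and \<open>cnt_spread\<close> bounds its size from
  below. To let the interval start at 0, \<open>D\<close> is shifted by \<open>q\<close>
  instead.\<close>

lemma cnt_avoid:
  assumes per: "periodic n C" "periodic n D" and "C i0" and t: "0 \<le> q" "q \<le> n - k" 
    and avoid: "\<And>i j. C i \<Longrightarrow> D j \<Longrightarrow> (j - i) mod n \<notin> {q..n - k}"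
  shows "min (nat n) (cnt n C + nat (n - k - q)) + cnt n D \<le> nat n"
proof -
  let ?t = "nat (n - k - q)"
  let ?D = "\<lambda>i. D (i + q)"
  have perD: "periodic n ?D" by (rule periodic_shift[OF per(2)])
  have "cnt n ?D = cnt n D" by (rule cnt_shift[OF n0 per(2)])
  moreover have "\<not> (spread ?t C i \<and> ?D i)" for i
  proof
    assume "spread ?t C i \<and> ?D i"
    then obtain u where u: "u \<in> {0..int ?t}" "C (i - u)" "D (i + q)" unfolding spread_def by blast
    then have "(i + q - (i - u)) mod n \<notin> {q..n - k}" using avoid by blast
    moreover have "(i + q - (i - u)) mod n = q + u"
      using u(1) t p n by (simp add: mod_pos_pos_trivial)
    ultimately show False using u(1) t by auto
  qed
  then have "cnt n (spread ?t C) + cnt n ?D \<le> nat n"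
    using cnt_disjoint[of "spread ?t C" ?D n] cnt_le[OF n0] by metis
  ultimately show ?thesis
    using cnt_spread[OF n0 per(1) \<open>C i0\<close>, of ?t] by linarith
qed

text \<open>Case \<open>q = k\<close> of \<open>cnt_avoid\<close> with both sets equal; positivity
  of the count excludes that the minimum is \<open>n\<close>.\<close>

lemma cnt_self:
  assumes "periodic n C" and "\<And>i j. C i \<Longrightarrow> C j \<Longrightarrow> (j - i) mod n \<notin> {k..n - k}"
  shows "cnt n C \<le> nat k"
proof (cases "\<exists>i. C i")
  case True
  then obtain i where "C i" by blast
  have "cnt n C > 0" by (rule cnt_pos[OF n0 assms(1) \<open>C i\<close>])
  then show ?thesis
    using cnt_avoid[OF assms(1) assms(1) \<open>C i\<close> _ _ assms(2)] p n by linarith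
qed (simp add: cnt_def)

text \<open>Case \<open>q = p\<close> of \<open>cnt_avoid\<close>. If one set is empty, the bound
  \<open>k\<close> for the other suffices.\<close>

lemma cnt_sum_le: "cnt n A + cnt n B \<le> nat (k + p)"
proof (cases "(\<exists>i. A i) \<and> (\<exists>i. B i)")
  case True
  then obtain i j where "A i" "B j" by blast
  have "cnt n B > 0" by (rule cnt_pos[OF n0 perB \<open>B j\<close>])
  then show ?thesis
    using cnt_avoid[OF perA perB \<open>A i\<close> _ _ cross] p n by linarith
next
  case False
  then have "cnt n A = 0 \<or> cnt n B = 0" by (auto simp: cnt_def)
  then show ?thesis using cnt_self[OF perA selfA] cnt_self[OF perB selfB] p by linarith
qed

lemma tight_nonempty:
  assumes "cnt n A + cnt n B = nat (k + p)"
  obtains i j where "A i" "B j"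
proof -
  have "cnt n A > 0" "cnt n B > 0"
    using assms cnt_self[OF perA selfA] cnt_self[OF perB selfB] p by linarith+
  then show ?thesis using that unfolding cnt_def card_gt_0_iff by blast
qed

lemma tight_boundary_exists:
  assumes "cnt n A + cnt n B = nat (k + p)"
  obtains i where "A i" "\<not> A (i + 1)"
proof -
  obtain i where "A i" using tight_nonempty[OF assms] by blast
  have "(i + k - i) mod n = k" using p n by simp
  then have "\<not> A (i + k)" using selfA[OF \<open>A i\<close>, of "i + k"] p n by auto
  then show ?thesis using boundary_exists[OF n0 perA \<open>A i\<close>] that by blast
qed

text \<open>In the tight case \<open>A\<close> has a single right end \<open>a\<close>, since a second one would make
  \<open>A + {p..n - k}\<close> too large, and \<open>B\<close> consists of all indices outside this sumset.\<close>

lemma tight_right_end: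
  assumes tight: "cnt n A + cnt n B = nat (k + p)" and big: "2 * k < n"
    and a: "A a" "\<not> A (a + 1)"
  shows "B (a + 1 - k)"
proof (rule ccontr)
  assume nB: "\<not> B (a + 1 - k)"
  let ?t = "nat (n - k - p)"
  obtain j where "B j" using tight_nonempty[OF tight] by blast
  have Bpos: "cnt n B > 0" by (rule cnt_pos[OF n0 perB \<open>B j\<close>])
  let ?B = "\<lambda>i. B (i + p)"
  have cB: "cnt n ?B = cnt n B" by (rule cnt_shift[OF n0 perB])
  have perB': "periodic n ?B" by (rule periodic_shift[OF perB])
  have disj: "\<not> (spread ?t A i \<and> ?B i)" for i
  proof
    assume "spread ?t A i \<and> ?B i"
    then obtain u where u: "u \<in> {0..int ?t}" "A (i - u)" "B (i + p)" unfolding spread_def by blast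
    then have "(i + p - (i - u)) mod n \<notin> {p..n - k}" using cross by blast
    moreover have "(i + p - (i - u)) mod n = p + u"
      using u(1) p n by (simp add: mod_pos_pos_trivial)
    ultimately show False using u(1) p n by auto
  qed
  have le: "cnt n (spread ?t A) + cnt n B \<le> nat n"
    using cnt_disjoint[of "spread ?t A" ?B n] cnt_le[OF n0] cB disj by metis
  have t1: "?t = Suc (nat (n - k - p - 1))" using big p by simp
  have uniq: "b mod n = a mod n" if "A b" "\<not> A (b + 1)" for b
  proof (rule ccontr)
    assume "b mod n \<noteq> a mod n"
    from cnt_spread_two_ends[OF n0 perA that a this, of "nat (n - k - p - 1)"]
    have "min (nat n) (cnt n A + ?t + 1) \<le> cnt n (spread ?t A)" using t1 by simp
    then show False using le Bpos tight p n by linarith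
  qed
  \<comment> \<open>Tightness leaves no residue outside the sumset and the shifted \<open>B\<close>.
    As \<open>a + 1 - k\<close> is not in \<open>B\<close>, its shift must lie in the
    sumset.\<close>
  have "min (nat n) (cnt n A + ?t) \<le> cnt n (spread ?t A)"
    by (rule cnt_spread[OF n0 perA a(1)])
  then have "nat n \<le> cnt n (spread ?t A) + cnt n ?B" using tight p n cB by linarith
  then have "nat n \<le> cnt n (\<lambda>i. spread ?t A i \<or> ?B i)"
    using cnt_disjoint[of "spread ?t A" ?B n] disj by simp
  moreover have "periodic n (\<lambda>i. spread ?t A i \<or> ?B i)"
    using periodic_spread[OF perA] perB' unfolding periodic_def by metis
  ultimately have "spread ?t A (a + 1 - k - p) \<or> ?B (a + 1 - k - p)"
    using cnt_full[OF n0] by blast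
  then have "spread ?t A (a + 1 - k - p)" using nB by simp
  then obtain u where u: "u \<in> {0..int ?t}" "A (a + 1 - k - p - u)" unfolding spread_def by blast
  \<comment> \<open>One full turn further, the member of \<open>A\<close> just found is
    \<open>a + c\<close>. The range of \<open>u\<close> gives 1 <= \<open>c\<close> and, since
    \<open>p\<close> is positive, \<open>c + k\<close> <= \<open>n\<close>.\<close>
  define c where "c = n + 1 - k - p - u"
  have c: "1 \<le> c" "c \<le> n + 1 - k - p" using u(1) p n unfolding c_def by auto
  have "A (a + c)"
    using u(2) periodic_cong[OF perA, of "a + c" "a + 1 - k - p - u"]
    by (simp add: c_def mod_eq_dvd_iff)
  \<comment> \<open>Going up from \<open>a + c\<close>, no right end occurs before
    \<open>a + n\<close>, so \<open>A\<close> continues for \<open>k\<close> steps and contains two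
    members at the forbidden difference \<open>k\<close>.\<close>
  have walk: "c + int m \<le> n \<Longrightarrow> A (a + c + int m)" for m
  proof (induction m)
    case (Suc m)
    then have Am: "A (a + c + int m)" by simp
    show ?case
    proof (rule ccontr)
      assume "\<not> A (a + c + int (Suc m))"
      then have "(a + c + int m) mod n = a mod n" using uniq[OF Am] by (simp add: algebra_simps)
      then have "n dvd c + int m" by (simp add: mod_eq_dvd_iff algebra_simps)
      then show False using zdvd_imp_le[of n "c + int m"] Suc.prems c by simp
    qed
  qed (use \<open>A (a + c)\<close> in simp)
  have "A (a + c + int (nat k))"
    by (rule walk) (use c p n in auto)
  moreover have "(a + c + int (nat k) - (a + c)) mod n = k" using p n by simp
  ultimately show False using selfA[OF \<open>A (a + c)\<close>, of "a + c + int (nat k)"] n by auto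
qed

end

text \<open>Reflection reverses differences, hence exchanges the roles of the two sets and turns
  left ends of \<open>B\<close> into right ends.\<close>

lemma cyclic_pair_reflect:
  assumes "cyclic_pair n p k A B"
  shows "cyclic_pair n p k (\<lambda>i. B (- i)) (\<lambda>i. A (- i))"
proof -
  interpret cyclic_pair n p k A B by fact
  show ?thesis
  proof
    show "periodic n (\<lambda>i. B (- i))" "periodic n (\<lambda>i. A (- i))"
      by (rule periodic_uminus[OF perB], rule periodic_uminus[OF perA])
    show "(j - i) mod n \<notin> {p..n - k}" if "B (- i)" "A (- j)" for i j
      using cross[OF that(2,1)] by (simp add: algebra_simps)
    show "(j - i) mod n \<notin> {k..n - k}" if "B (- i)" "B (- j)" for i j
      using selfB[OF that(2,1)] by (simp add: algebra_simps)
    show "(j - i) mod n \<notin> {k..n - k}" if "A (- i)" "A (- j)" for i j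
      using selfA[OF that(2,1)] by (simp add: algebra_simps)
  qed (use p n in auto)
qed

lemma (in cyclic_pair) tight_left_end:
  assumes tight: "cnt n A + cnt n B = nat (k + p)" and big: "2 * k < n"
    and b: "B b" "\<not> B (b - 1)"
  shows "A (b - 1 + k)"
proof -
  interpret R: cyclic_pair n p k "\<lambda>i. B (- i)" "\<lambda>i. A (- i)"
    by (rule cyclic_pair_reflect) unfold_locales
  have "cnt n (\<lambda>i. B (- i)) + cnt n (\<lambda>i. A (- i)) = nat (k + p)"
    using cnt_reflect[OF n0 perA] cnt_reflect[OF n0 perB] tight by simp
  from R.tight_right_end[OF this big, of "- b"] b show ?thesis
    by (simp add: algebra_simps)
qed

section \<open>Automorphisms of the perfect matching graph\<close>

fun bar :: "vertex \<Rightarrow> vertex" where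
  "bar (Lvert m) = Rvert m"
| "bar (Rvert m) = Lvert m"

fun edge_of :: "vertex \<Rightarrow> nat" where
  "edge_of (Lvert m) = m"
| "edge_of (Rvert m) = m"

lemma bar_bar [simp]: "bar (bar v) = v"
  by (cases v) auto

lemma bar_neq [simp]: "bar v \<noteq> v" "v \<noteq> bar v"
  by (cases v; simp)+

lemma bar_eq_iff [simp]: "bar v = bar w \<longleftrightarrow> v = w"
  by (metis bar_bar)

lemma edge_of_bar [simp]: "edge_of (bar v) = edge_of v"
  by (cases v) auto

lemma edge_of_eq_iff: "edge_of v = edge_of w \<longleftrightarrow> v = w \<or> v = bar w"
  by (cases v; cases w) auto

lemma mem_M_verts: "v \<in> M_verts n \<longleftrightarrow> edge_of v \<in> {1..n}"
  by (cases v) (auto simp: M_verts_def)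

lemma bar_mem_M_verts [simp]: "bar v \<in> M_verts n \<longleftrightarrow> v \<in> M_verts n"
  by (simp add: mem_M_verts)

text \<open>A description through \<open>bar\<close> alone, which makes invariance under maps
  commuting with \<open>bar\<close> visible. Each full edge is counted at both ends, whence
  \<open>2 * p\<close>.\<close>

lemma mem_H_family_bar_iff:
  "H \<in> H_family p s n \<longleftrightarrow> H \<subseteq> M_verts n \<and>
     card {v \<in> H. bar v \<in> H} = 2 * p \<and> card {v \<in> H. bar v \<notin> H} = s"
proof (cases "H \<subseteq> M_verts n")
  case True
  let ?I = "\<lambda>c. {i \<in> {1..n}. card (M_edge i \<inter> H) = c}"
  have cases: "M_edge i \<inter> H =
      (if Lvert i \<in> H then {Lvert i} else {}) \<union> (if Rvert i \<in> H then {Rvert i} else {})" for i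
    by (auto simp: M_edge_def)
  have two: "card (M_edge i \<inter> H) = 2 \<longleftrightarrow> Lvert i \<in> H \<and> Rvert i \<in> H" for i
    unfolding cases by auto
  have one: "card (M_edge i \<inter> H) = 1 \<longleftrightarrow> (Lvert i \<in> H) \<noteq> (Rvert i \<in> H)" for i
    unfolding cases by auto
  have rng: "edge_of v \<in> {1..n}" if "v \<in> H" for v
    using True that mem_M_verts by blast
  have "v \<in> Lvert ` ?I 2 \<union> Rvert ` ?I 2" if "v \<in> H" "bar v \<in> H" for v
    using that rng[of v] unfolding two by (cases v) auto
  moreover have "v \<in> H \<and> bar v \<in> H" if "v \<in> Lvert ` ?I 2 \<union> Rvert ` ?I 2" for v
    using that unfolding two by auto
  ultimately have "{v \<in> H. bar v \<in> H} = Lvert ` ?I 2 \<union> Rvert ` ?I 2"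
    by blast
  moreover have "card (Lvert ` ?I 2 \<union> Rvert ` ?I 2) = card (Lvert ` ?I 2) + card (Rvert ` ?I 2)"
    by (rule card_Un_disjoint) auto
  ultimately have full: "card {v \<in> H. bar v \<in> H} = 2 * card (?I 2)"
    by (simp add: card_image inj_on_def)
  have "bij_betw edge_of {v \<in> H. bar v \<notin> H} (?I 1)"
  proof (rule bij_betw_imageI)
    show "inj_on edge_of {v \<in> H. bar v \<notin> H}"
      by (rule inj_onI) (use edge_of_eq_iff in fastforce)
    have "edge_of v \<in> ?I 1" if "v \<in> H" "bar v \<notin> H" for v
      using that rng[of v] unfolding one by (cases v) auto
    moreover have "i \<in> edge_of ` {v \<in> H. bar v \<notin> H}" if "i \<in> ?I 1" for i
    proof (cases "Lvert i \<in> H")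
      case True
      then show ?thesis using that unfolding one by (intro image_eqI[of _ _ "Lvert i"]) auto
    next
      case False
      then show ?thesis using that unfolding one by (intro image_eqI[of _ _ "Rvert i"]) auto
    qed
    ultimately show "edge_of ` {v \<in> H. bar v \<notin> H} = ?I 1"
      by blast
  qed
  then have "card {v \<in> H. bar v \<notin> H} = card (?I 1)"
    by (rule bij_betw_same_card)
  then show ?thesis
    using full True unfolding mem_H_family_iff by auto
qed (simp add: mem_H_family_iff)

text \<open>Commuting with the partner map expresses that edges go to edges; \<open>permutes\<close>
  fixes all points off the vertex set, which makes the group finite.\<close>

definition autos :: "nat \<Rightarrow> (vertex \<Rightarrow> vertex) set" where
  "autos n = {g. g permutes M_verts n \<and> (\<forall>v. g (bar v) = bar (g v))}"

lemma autosD: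
  assumes "g \<in> autos n"
  shows "g permutes M_verts n" "g (bar v) = bar (g v)" "inj g" "bij g"
    "g v = g w \<longleftrightarrow> v = w" "g v \<in> M_verts n \<longleftrightarrow> v \<in> M_verts n"
proof -
  show g: "g permutes M_verts n" and "g (bar v) = bar (g v)"
    using assms by (simp_all add: autos_def)
  show "inj g" "bij g" "g v \<in> M_verts n \<longleftrightarrow> v \<in> M_verts n"
    by (rule permutes_inj[OF g], rule permutes_bij[OF g], rule permutes_in_image[OF g])
  then show "g v = g w \<longleftrightarrow> v = w" by (simp add: inj_eq)
qed

lemma finite_autos: "finite (autos n)"
  by (rule finite_subset[OF _ finite_permutations[OF finite_M_verts[of n]]]) (auto simp: autos_def)

lemma id_autos: "id \<in> autos n"
  by (simp add: autos_def permutes_id)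

lemma comp_autos: "g \<in> autos n \<Longrightarrow> h \<in> autos n \<Longrightarrow> g \<circ> h \<in> autos n"
  by (simp add: autos_def permutes_compose)

lemma inv_autos:
  assumes "g \<in> autos n"
  shows "inv g \<in> autos n"
proof -
  have "inv g (bar v) = bar (inv g v)" for v
    by (rule inv_f_eq[OF autosD(3)[OF assms]])
      (simp add: autosD(2)[OF assms] permutes_inverses(1)[OF autosD(1)[OF assms]])
  then show ?thesis using assms by (simp add: autos_def permutes_inv)
qed

lemma autos_inv_simps [simp]:
  assumes "g \<in> autos n"
  shows "g (inv g v) = v" "inv g (g v) = v" "g ` inv g ` X = X" "inv g ` g ` X = X"
  using permutes_inverses[OF autosD(1)[OF assms]] by (simp_all add: image_image)

lemma image_H_family:
  assumes g: "g \<in> autos n"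
  shows "g ` H \<in> H_family p s n \<longleftrightarrow> H \<in> H_family p s n"
proof -
  have mem: "g v \<in> g ` H \<longleftrightarrow> v \<in> H" for v
    using autosD(3)[OF g] by (simp add: inj_image_mem_iff)
  have bmem: "bar (g v) \<in> g ` H \<longleftrightarrow> bar v \<in> H" for v
    using mem[of "bar v"] autosD(2)[OF g, of v] by simp
  have "{v \<in> g ` H. bar v \<in> g ` H} = g ` {v \<in> H. bar v \<in> H}"
    "{v \<in> g ` H. bar v \<notin> g ` H} = g ` {v \<in> H. bar v \<notin> H}"
    using bmem by blast+
  moreover have "card (g ` X) = card X" for X
    by (rule card_image) (use autosD(3)[OF g] in \<open>simp add: inj_on_def inj_def\<close>)
  moreover have "g ` H \<subseteq> M_verts n \<longleftrightarrow> H \<subseteq> M_verts n"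
    using autosD(6)[OF g] by blast
  ultimately show ?thesis unfolding mem_H_family_bar_iff by simp
qed

text \<open>The numbers of points on the edges have the same distribution for all members, so some
  permutation of the edges matches these numbers; a suitable orientation of each edge turns it into
  an automorphism.\<close>

lemma autos_transitive:
  assumes K: "K \<in> H_family p s n" and H: "H \<in> H_family p s n"
  obtains g where "g \<in> autos n" "g ` K = H"
proof -
  define f where "f X i = card (M_edge i \<inter> X)" for X i
  have fle: "f X i \<le> 2" for X i
    unfolding f_def by (rule order_trans[OF card_mono[of "M_edge i"]]) (auto simp: M_edge_def)
  have cnt: "card {i \<in> {1..n}. f X i = c} =
      (if c = 2 then p else if c = 1 then s else if c = 0 then n - p - s else 0)"
    if X: "X \<in> H_family p s n" for X c
  proof -
    have c2: "card {i \<in> {1..n}. f X i = 2} = p" and c1: "card {i \<in> {1..n}. f X i = 1} = s"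
      using X unfolding mem_H_family_iff f_def by blast+
    have "{1..n} = {i \<in> {1..n}. f X i = 2} \<union> {i \<in> {1..n}. f X i = 1} \<union> {i \<in> {1..n}. f X i = 0}"
    proof -
      have "f X i = 2 \<or> f X i = 1 \<or> f X i = 0" for i
        using fle[of X i] by linarith
      then show ?thesis by blast
    qed
    then have "card {1..n} = card ({i \<in> {1..n}. f X i = 2} \<union> {i \<in> {1..n}. f X i = 1} \<union>
        {i \<in> {1..n}. f X i = 0})" by (rule arg_cong)
    also have "\<dots> = card ({i \<in> {1..n}. f X i = 2} \<union> {i \<in> {1..n}. f X i = 1}) +
        card {i \<in> {1..n}. f X i = 0}"
      by (rule card_Un_disjoint) auto
    also have "card ({i \<in> {1..n}. f X i = 2} \<union> {i \<in> {1..n}. f X i = 1}) = p + s"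
      unfolding c2[symmetric] c1[symmetric] by (rule card_Un_disjoint) auto
    finally have c0: "card {i \<in> {1..n}. f X i = 0} = n - p - s" by simp
    have "{i \<in> {1..n}. f X i = c} = {}" if "c \<noteq> 0" "c \<noteq> 1" "c \<noteq> 2"
    proof -
      have "f X i \<noteq> c" for i
        using fle[of X i] that by linarith
      then show ?thesis by blast
    qed
    then have "card {i \<in> {1..n}. f X i = c} = 0" if "c \<noteq> 0" "c \<noteq> 1" "c \<noteq> 2"
      using that by (metis card.empty)
    then show ?thesis using c0 c1 c2 by auto
  qed
  have "image_mset (f K) (mset_set {1..n}) = image_mset (f H) (mset_set {1..n})"
  proof (rule multiset_eqI)
    fix c
    have "count (image_mset (f X) (mset_set {1..n})) c = card {i \<in> {1..n}. f X i = c}" for X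
      by (rule count_image_mset_eq_card_vimage) simp
    then show "count (image_mset (f K) (mset_set {1..n})) c =
        count (image_mset (f H) (mset_set {1..n})) c"
      by (simp only: cnt[OF K] cnt[OF H])
  qed
  then obtain q where q: "q permutes {1..n}" and "\<forall>i\<in>{1..n}. f K i = f H (q i)"
    by (rule image_mset_eq_implies_permutes[OF finite_atLeastAtMost])
  then have fq: "f K i = f H (q i)" if "i \<in> {1..n}" for i
    using that by blast
  \<comment> \<open>\<open>o'\<close> selects on each edge an end that lies in \<open>X\<close>
    whenever the edge meets \<open>X\<close>; the partner lies in \<open>X\<close> exactly for full
    edges. Sending selected ends to selected ends therefore carries \<open>K\<close> to
    \<open>H\<close>.\<close>
  define o' where "o' X i = (if Lvert i \<in> X then Lvert i else Rvert i)" for X i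
  have eo [simp]: "edge_of (o' X i) = i" for X i by (simp add: o'_def)
  have vo: "v = o' X (edge_of v) \<or> v = bar (o' X (edge_of v))" for v X
    using edge_of_eq_iff eo by metis
  have M: "M_edge i \<inter> X =
      (if Lvert i \<in> X then {Lvert i} else {}) \<union> (if Rvert i \<in> X then {Rvert i} else {})" for i X
    by (auto simp: M_edge_def)
  have o1: "o' X i \<in> X \<longleftrightarrow> f X i \<ge> 1" "bar (o' X i) \<in> X \<longleftrightarrow> f X i \<ge> 2" for X i
    unfolding f_def M o'_def by auto
  define g where "g v = (if edge_of v \<notin> {1..n} then v
      else if v = o' K (edge_of v) then o' H (q (edge_of v)) else bar (o' H (q (edge_of v))))" for v
  have ge: "edge_of (g v) = q (edge_of v)" for v
    using permutes_not_in[OF q] by (simp add: g_def)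
  have g_out: "g v = v" if "edge_of v \<notin> {1..n}" for v
    using that by (simp add: g_def)
  have g_o: "g (o' K i) = o' H (q i)" "g (bar (o' K i)) = bar (o' H (q i))" if "i \<in> {1..n}" for i
    using that by (simp_all add: g_def)
  have gbar: "g (bar v) = bar (g v)" for v
  proof (cases "edge_of v \<in> {1..n}")
    case True
    show ?thesis
      using vo[of v K]
    proof
      assume "v = o' K (edge_of v)"
      then show ?thesis using g_o[OF True] by metis
    next
      assume "v = bar (o' K (edge_of v))"
      then show ?thesis using g_o[OF True] bar_bar by metis
    qed
  qed (simp add: g_out)
  have "inj g"
  proof (rule injI)
    fix v w assume eq: "g v = g w"
    then have "q (edge_of v) = q (edge_of w)" using ge by metis
    then have "edge_of v = edge_of w" using permutes_inj[OF q] by (simp add: inj_def)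
    moreover have "v \<noteq> bar w" using eq gbar[of w] by auto
    ultimately show "v = w" by (simp add: edge_of_eq_iff)
  qed
  have gM: "g v \<in> M_verts n \<longleftrightarrow> v \<in> M_verts n" for v
    using permutes_in_image[OF q] by (simp add: mem_M_verts ge)
  have "g ` M_verts n = M_verts n"
    by (rule endo_inj_surj) (use finite_M_verts \<open>inj g\<close> gM in \<open>auto simp: inj_on_def inj_def\<close>)
  then have "bij_betw g (M_verts n) (M_verts n)"
    using \<open>inj g\<close> by (auto simp: bij_betw_def inj_on_def inj_def)
  then have "g permutes M_verts n"
    by (rule bij_imp_permutes) (simp add: g_def mem_M_verts)
  have gmem: "g v \<in> H \<longleftrightarrow> v \<in> K" if "v \<in> M_verts n" for v
  proof -
    have e: "edge_of v \<in> {1..n}" using that mem_M_verts by blast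
    have "g v \<in> H \<longleftrightarrow> v \<in> K" if "v = o' K i" "i \<in> {1..n}" for i
      using that g_o(1)[OF that(2)] o1(1)[of K i] o1(1)[of H "q i"] fq[OF that(2)] by simp
    moreover have "g v \<in> H \<longleftrightarrow> v \<in> K" if "v = bar (o' K i)" "i \<in> {1..n}" for i
      using that g_o(2)[OF that(2)] o1(2)[of K i] o1(2)[of H "q i"] fq[OF that(2)] by simp
    ultimately show ?thesis using vo[of v K] e by blast
  qed
  have "g ` K = H"
  proof
    show "g ` K \<subseteq> H" using gmem K H_family_subset by blast
    show "H \<subseteq> g ` K"
    proof
      fix w assume "w \<in> H"
      then have "w \<in> g ` M_verts n" using \<open>g ` M_verts n = M_verts n\<close> H H_family_subset by blast
      then show "w \<in> g ` K" using gmem \<open>w \<in> H\<close> by blast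
    qed
  qed
  have "g \<in> autos n"
    using \<open>g permutes M_verts n\<close> gbar by (simp add: autos_def)
  then show ?thesis using that \<open>g ` K = H\<close> by blast
qed

text \<open>Exchanges \<open>u\<close> with \<open>w\<close> and simultaneously their partners; for \<open>w = bar u\<close> this flips
  a single edge.\<close>

definition swap :: "vertex \<Rightarrow> vertex \<Rightarrow> vertex \<Rightarrow> vertex" where
  "swap u w v = (if v = u then w else if v = w then u
     else if v = bar u then bar w else if v = bar w then bar u else v)"

lemma swap_simps [simp]:
  "swap u w u = w" "swap u w w = u" "swap u w (bar u) = bar w" "swap u w (bar w) = bar u"
  by (auto simp: swap_def)

lemma swap_other':
  "v \<noteq> u \<Longrightarrow> v \<noteq> w \<Longrightarrow> v \<noteq> bar u \<Longrightarrow> v \<noteq> bar w \<Longrightarrow> swap u w v = v"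
  by (simp add: swap_def)

lemma swap_cases:
  obtains "v = u" | "v = w" | "v = bar u" | "v = bar w"
  | "v \<noteq> u" "v \<noteq> w" "v \<noteq> bar u" "v \<noteq> bar w"
  by blast

lemma swap_swap [simp]: "swap u w (swap u w v) = v"
  by (rule swap_cases[where v = v and u = u and w = w]) (simp_all add: swap_other')

lemma swap_comp [simp]: "swap u w \<circ> swap u w = id"
  by (simp add: fun_eq_iff)

lemma swap_bar: "swap u w (bar v) = bar (swap u w v)"
proof (rule swap_cases[where v = v and u = u and w = w])
  assume "v \<noteq> u" "v \<noteq> w" "v \<noteq> bar u" "v \<noteq> bar w"
  moreover from this have "bar v \<noteq> u" "bar v \<noteq> w" by (metis bar_bar)+
  ultimately show ?thesis by (simp add: swap_other')
qed simp_all

lemma swap_same: "swap u u = id"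
  by (auto simp: fun_eq_iff swap_def)

lemma swap_commute: "swap u w v = swap w u v"
  by (rule swap_cases[where v = v and u = u and w = w]) (simp_all add: swap_other')

lemma swap_bar_bar: "swap (bar u) (bar w) v = swap u w v"
proof (rule swap_cases[where v = v and u = u and w = w])
  assume "v = u"
  then show ?thesis using swap_simps(3)[of "bar u" "bar w"] by simp
next
  assume "v = w"
  then show ?thesis using swap_simps(4)[of "bar u" "bar w"] by simp
qed (simp_all add: swap_other')

lemma swap_other: "edge_of v \<noteq> edge_of u \<Longrightarrow> edge_of v \<noteq> edge_of w \<Longrightarrow> swap u w v = v"
  by (auto simp: swap_def)

lemma swap_autos:
  assumes "u \<in> M_verts n" "w \<in> M_verts n"
  shows "swap u w \<in> autos n"
proof -
  have M: "swap u w v \<in> M_verts n \<longleftrightarrow> v \<in> M_verts n" for v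
    by (rule swap_cases[where v = v and u = u and w = w]) (simp_all add: assms swap_other')
  have "bij_betw (swap u w) (M_verts n) (M_verts n)"
    by (rule bij_betw_byWitness[of _ "swap u w"]) (use M in auto)
  then have "swap u w permutes M_verts n"
  proof (rule bij_imp_permutes)
    show "swap u w v = v" if "v \<notin> M_verts n" for v
      by (rule swap_other') (use that assms in auto)
  qed
  then show ?thesis by (simp add: autos_def swap_bar)
qed

lemma swap_image:
  assumes "u \<in> H \<longleftrightarrow> w \<in> H" "bar u \<in> H \<longleftrightarrow> bar w \<in> H"
  shows "swap u w ` H = H"
proof -
  have "swap u w v \<in> H" if "v \<in> H" for v
    by (rule swap_cases[where v = v and u = u and w = w])
      (use assms that in \<open>simp_all add: swap_other'\<close>)
  then have "swap u w ` H \<subseteq> H" by blast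
  moreover from image_mono[OF this, of "swap u w"] have "H \<subseteq> swap u w ` H"
    by (simp add: image_image)
  ultimately show ?thesis by (rule subset_antisym)
qed

text \<open>The image of \<open>a\<close> under a transporting automorphism has the same membership
  pattern in \<open>H\<close> as \<open>b\<close>, so the swap taking it to \<open>b\<close> leaves
  \<open>H\<close> fixed.\<close>

lemma autos_transitive_pinned:
  assumes "K \<in> H_family p s n" "H \<in> H_family p s n" "a \<in> M_verts n" "b \<in> M_verts n"
    and "a \<in> K \<longleftrightarrow> b \<in> H" "bar a \<in> K \<longleftrightarrow> bar b \<in> H"
  obtains g where "g \<in> autos n" "g ` K = H" "g a = b"
proof -
  obtain g where g: "g \<in> autos n" "g ` K = H"
    using autos_transitive[OF assms(1,2)] by blast
  have mem: "g v \<in> H \<longleftrightarrow> v \<in> K" for v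
    using autosD(3)[OF g(1)] g(2) by (metis inj_image_mem_iff)
  have "swap (g a) b ` H = H"
    by (rule swap_image) (use assms(5,6) mem[of a] mem[of "bar a"] autosD(2)[OF g(1)] in auto)
  moreover have "swap (g a) b \<circ> g \<in> autos n"
    by (intro comp_autos swap_autos g) (use assms(3,4) autosD(6)[OF g(1)] in auto)
  moreover have "(swap (g a) b \<circ> g) ` K = swap (g a) b ` H"
    unfolding g(2)[symmetric] by (rule image_comp[symmetric])
  ultimately show ?thesis using that[of "swap (g a) b \<circ> g"] by simp
qed

section \<open>Generation of automorphism groups by swaps\<close>

lemma conj_swap:
  assumes "g \<in> autos n"
  shows "g \<circ> swap u w = swap (g u) (g w) \<circ> g"
proof (rule ext, unfold o_apply)
  fix v
  note gb = autosD(2)[OF assms] and inj = autosD(5)[OF assms]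
  show "g (swap u w v) = swap (g u) (g w) (g v)"
  proof (rule swap_cases[where v = v and u = u and w = w])
    assume "v \<noteq> u" "v \<noteq> w" "v \<noteq> bar u" "v \<noteq> bar w"
    moreover from this have "g v \<noteq> bar (g u)" "g v \<noteq> bar (g w)"
      unfolding gb[symmetric] inj by simp_all
    ultimately show ?thesis by (simp add: swap_other' inj)
  qed (simp_all add: gb)
qed

text \<open>Since a swap is its own inverse, conjugating by it is a plain composition of elements of
  \<open>R\<close>.\<close>

lemma conj_swap_mem:
  assumes comp: "\<And>f g. f \<in> R \<Longrightarrow> g \<in> R \<Longrightarrow> f \<circ> g \<in> R"
    and "swap a b \<in> R" "swap c d \<in> R" "a \<in> M_verts n" "b \<in> M_verts n"
  shows "swap (swap a b c) (swap a b d) \<in> R"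
proof -
  have "swap a b \<circ> swap c d \<circ> swap a b = swap (swap a b c) (swap a b d)"
    by (simp add: conj_swap[OF swap_autos[OF assms(4,5)]] comp_assoc)
  then show ?thesis using comp assms(2,3) by metis
qed

text \<open>Sorting by swaps: composing \<open>g\<close> with the swap of \<open>u\<close> and
  \<open>g u\<close> fixes \<open>u\<close> in addition to all points fixed before, so the number of
  moved points decreases.\<close>

lemma swaps_generate:
  assumes W: "W \<subseteq> M_verts n" "\<And>v. v \<in> W \<Longrightarrow> bar v \<in> W"
    and "id \<in> R" and comp: "\<And>f g. f \<in> R \<Longrightarrow> g \<in> R \<Longrightarrow> f \<circ> g \<in> R"
    and sw: "\<And>u w. u \<in> W \<Longrightarrow> w \<in> W \<Longrightarrow> swap u w \<in> R"
    and "g \<in> autos n" "\<And>v. v \<notin> W \<Longrightarrow> g v = v"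
  shows "g \<in> R"
  using assms(6,7)
proof (induction "card {v. g v \<noteq> v}" arbitrary: g rule: less_induct)
  case (less g)
  note g = less.prems(1) and fixd = less.prems(2)
  have fin: "finite {v. g v \<noteq> v}"
    by (rule finite_subset[OF _ finite_subset[OF W(1) finite_M_verts]]) (use fixd in blast)
  show ?case
  proof (cases "\<exists>u. g u \<noteq> u")
    case False
    then have "g = id" by auto
    then show ?thesis using \<open>id \<in> R\<close> by simp
  next
    case True
    then obtain u where u: "g u \<noteq> u" by blast
    let ?h = "swap u (g u) \<circ> g"
    have uW: "u \<in> W" using u fixd by blast
    have gW: "g u \<in> W" using u fixd[of "g u"] autosD(5)[OF g] by blast
    have h: "?h \<in> autos n" by (intro comp_autos swap_autos g) (use uW gW W(1) in auto)
    have "{v. ?h v \<noteq> v} \<subset> {v. g v \<noteq> v}"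
    proof
      have "?h v = v" if "g v = v" for v
      proof -
        have "v \<noteq> u" using that u by blast
        moreover have "v \<noteq> g u" using that u autosD(5)[OF g] by blast
        moreover have "v \<noteq> bar u" using that u autosD(2)[OF g, of u] by force
        moreover have "v \<noteq> bar (g u)"
          using that u autosD(5)[OF g, of "bar u" v] autosD(2)[OF g, of u] by force
        ultimately show ?thesis using that by (simp add: swap_other')
      qed
      then show "{v. ?h v \<noteq> v} \<subseteq> {v. g v \<noteq> v}" by blast
      show "{v. ?h v \<noteq> v} \<noteq> {v. g v \<noteq> v}" 
      proof -
        have "u \<in> {v. g v \<noteq> v}" "u \<notin> {v. ?h v \<noteq> v}" using u by simp_all
        then show ?thesis by blast
      qed
    qed
    then have "card {v. ?h v \<noteq> v} < card {v. g v \<noteq> v}" by (rule psubset_card_mono[OF fin])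
    moreover have "?h v = v" if "v \<notin> W" for v
    proof -
      have "v \<noteq> u" "v \<noteq> g u" "v \<noteq> bar u" "v \<noteq> bar (g u)" using that uW gW W(2) by blast+
      then show ?thesis using fixd[OF that] by (simp add: swap_other')
    qed
    ultimately have "?h \<in> R" using less.hyps h by blast
    then have "swap u (g u) \<circ> ?h \<in> R" by (rule comp[OF sw[OF uW gW]])
    moreover have "swap u (g u) \<circ> ?h = g" by (auto simp: fun_eq_iff)
    ultimately show ?thesis by metis
  qed
qed

text \<open>Analogue of generating a symmetric group by the transpositions at one point. The flip of
  the hub edge turns a swap with one end of an edge into a swap with the other end, and conjugating
  hub swaps by each other yields all remaining swaps and flips.\<close>

lemma hub_swaps:
  assumes W: "W \<subseteq> M_verts n" "\<And>v. v \<in> W \<Longrightarrow> bar v \<in> W"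
    and "id \<in> R" and comp: "\<And>f g. f \<in> R \<Longrightarrow> g \<in> R \<Longrightarrow> f \<circ> g \<in> R"
    and h: "h \<in> W" "swap h (bar h) \<in> R"
    and hub: "\<And>u. u \<in> W \<Longrightarrow> edge_of u \<noteq> edge_of h \<Longrightarrow> swap h u \<in> R \<or> swap h (bar u) \<in> R"
    and u: "u \<in> W" and w: "w \<in> W"
  shows "swap u w \<in> R"
proof -
  have conj: "swap (swap a b c) (swap a b d) \<in> R"
    if "swap a b \<in> R" "swap c d \<in> R" "a \<in> W" "b \<in> W" for a b c d
    by (rule conj_swap_mem[where n = n]) (use that comp W(1) in auto)
  have star: "swap h v \<in> R" if v: "v \<in> W" for v
  proof (cases "edge_of v = edge_of h")
    case True
    then have "v = h \<or> v = bar h" by (simp add: edge_of_eq_iff)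
    moreover have "swap h h = id" by (rule swap_same)
    ultimately show ?thesis using h(2) \<open>id \<in> R\<close> by auto
  next
    case False
    have "swap h (bar h) (bar v) = bar v"
      by (rule swap_other) (use False in auto)
    moreover have "swap (bar h) (bar v) = swap h v" by (rule ext) (rule swap_bar_bar)
    ultimately have "swap h v \<in> R" if "swap h (bar v) \<in> R"
      using conj[OF h(2) that h(1) W(2)[OF h(1)]] by simp
    then show ?thesis using hub[OF v False] by blast
  qed
  have flip: "swap v (bar v) \<in> R" if v: "v \<in> W" for v
    using conj[OF star[OF v] h(2) h(1) v] by (simp add: swap_bar)
  show ?thesis
  proof (cases "edge_of u = edge_of w")
    case True
    then have "w = u \<or> w = bar u" by (auto simp: edge_of_eq_iff)
    moreover have "swap u u = id" by (rule swap_same)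
    ultimately show ?thesis using flip[OF u] \<open>id \<in> R\<close> by auto
  next
    case uw: False
    show ?thesis
    proof (cases "edge_of w = edge_of h")
      case True
      then consider "w = h" | "w = bar h" by (auto simp: edge_of_eq_iff)
      then show ?thesis
      proof cases
        case 1
        moreover have "swap u h = swap h u" by (rule ext) (rule swap_commute)
        ultimately show ?thesis using star[OF u] by simp
      next
        case 2
        moreover have "swap u (bar h) = swap h (bar u)"
          using swap_commute[of u "bar h"] swap_bar_bar[of h "bar u"] by (auto simp: fun_eq_iff)
        ultimately show ?thesis using star[OF W(2)[OF u]] by simp
      qed
    next
      case False
      then have "swap h u w = w" using uw by (intro swap_other) auto
      then show ?thesis using conj[OF star[OF u] star[OF w] h(1) u] by simp
    qed
  qed
qed

section \<open>The cycle method\<close>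

lemma intersecting_familyD:
  "intersecting_family \<F> \<Longrightarrow> A \<in> \<F> \<Longrightarrow> B \<in> \<F> \<Longrightarrow> A \<inter> B \<noteq> {}"
  by (simp add: intersecting_family_def)

lemma intersecting_star: "intersecting_family (star \<G> x)"
  by (auto simp: intersecting_family_def star_def)

locale matching_cycle =
  fixes p s n :: nat
  assumes s: "s \<ge> 1" and p: "p \<ge> 1" and n: "n \<ge> 2 * (p + s)"
begin

abbreviation fam :: "vertex set set" where
  "fam \<equiv> H_family p s n"

abbreviation N :: int where
  "N \<equiv> int n"

text \<open>The edges are arranged on a cycle of length \<open>n\<close>, edge \<open>n\<close> at position \<open>0\<close>.  The set
  \<open>arcL i\<close> consists of the \<open>p\<close> full edges \<open>i, \<dots>, i + p - 1\<close> followed by \<open>s\<close> left vertices, and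
  \<open>arcR i\<close> of \<open>s\<close> right vertices followed by \<open>p\<close> full edges, starting at position \<open>i\<close>.\<close>

definition arcL :: "int \<Rightarrow> vertex set" where
  "arcL i = {v \<in> M_verts n. case v of
     Lvert m \<Rightarrow> (int m - i) mod N < int (p + s) | Rvert m \<Rightarrow> (int m - i) mod N < int p}"

definition arcR :: "int \<Rightarrow> vertex set" where
  "arcR i = {v \<in> M_verts n. case v of
     Lvert m \<Rightarrow> int s \<le> (int m - i) mod N \<and> (int m - i) mod N < int (p + s)
   | Rvert m \<Rightarrow> (int m - i) mod N < int (p + s)}"

lemma mem_arcs:
  "Lvert m \<in> arcL i \<longleftrightarrow> m \<in> {1..n} \<and> (int m - i) mod N < int (p + s)"
  "Rvert m \<in> arcL i \<longleftrightarrow> m \<in> {1..n} \<and> (int m - i) mod N < int p"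
  "Lvert m \<in> arcR i \<longleftrightarrow> m \<in> {1..n} \<and> int s \<le> (int m - i) mod N \<and> (int m - i) mod N < int (p + s)"
  "Rvert m \<in> arcR i \<longleftrightarrow> m \<in> {1..n} \<and> (int m - i) mod N < int (p + s)"
  unfolding arcL_def arcR_def by (simp_all only: mem_Collect_eq mem_M_verts edge_of.simps vertex.case)

lemma n0: "n > 0" "N > 0"
  using n p by auto

lemma arcs_subset: "arcL i \<subseteq> M_verts n" "arcR i \<subseteq> M_verts n"
  by (auto simp: arcL_def arcR_def)

lemma cnt_interval:
  assumes "0 \<le> c" "c \<le> d" "d \<le> N"
  shows "cnt N (\<lambda>z. c \<le> (z + e) mod N \<and> (z + e) mod N < d) = nat (d - c)"
proof -
  let ?P = "\<lambda>z. c \<le> z mod N \<and> z mod N < d"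
  have "periodic N ?P" by (simp add: periodic_def)
  then have "cnt N (\<lambda>z. ?P (z + e)) = cnt N ?P" by (rule cnt_shift[OF n0(2)])
  also have "{i \<in> {0..<N}. ?P i} = {c..<d}"
    using assms by auto
  then have "cnt N ?P = nat (d - c)" unfolding cnt_def by simp
  finally show ?thesis .
qed

lemma card_arc:
  assumes "0 \<le> c" "c \<le> d" "d \<le> N"
  shows "card {m \<in> {1..n}. c \<le> (int m - i) mod N \<and> (int m - i) mod N < d} = nat (d - c)"
proof -
  \<comment> \<open>Edge labels start at 1 while \<open>cnt\<close> counts from 0; this accounts for
    the offset \<open>1 - i\<close>.\<close>
  let ?Q = "\<lambda>z. c \<le> (z + (1 - i)) mod N \<and> (z + (1 - i)) mod N < d"
  have "bij_betw (\<lambda>z. nat (z + 1)) {z \<in> {0..<N}. ?Q z}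
      {m \<in> {1..n}. c \<le> (int m - i) mod N \<and> (int m - i) mod N < d}"
  proof (rule bij_betw_byWitness[of _ "\<lambda>m. int m - 1"])
    show "(\<lambda>m. int m - 1) ` {m \<in> {1..n}. c \<le> (int m - i) mod N \<and> (int m - i) mod N < d}
        \<subseteq> {z \<in> {0..<N}. ?Q z}"
      by (auto simp: algebra_simps)
    have "nat (z + 1) \<in> {m \<in> {1..n}. c \<le> (int m - i) mod N \<and> (int m - i) mod N < d}"
      if "z \<in> {0..<N}" "?Q z" for z
    proof -
      have "int (nat (z + 1)) - i = z + (1 - i)" "nat (z + 1) \<in> {1..n}"
        using that(1) by auto
      then show ?thesis using that(2) unfolding mem_Collect_eq by (simp only:)
    qed
    then show "(\<lambda>z. nat (z + 1)) ` {z \<in> {0..<N}. ?Q z}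
        \<subseteq> {m \<in> {1..n}. c \<le> (int m - i) mod N \<and> (int m - i) mod N < d}"
      by blast
  qed auto
  then show ?thesis
    using cnt_interval[OF assms, of "1 - i"] unfolding cnt_def by (simp add: bij_betw_same_card)
qed

lemma arcs_mem_fam: "arcL i \<in> fam" "arcR i \<in> fam"
proof -
  let ?S = "\<lambda>c d. {m \<in> {1..n}. c \<le> (int m - i) mod N \<and> (int m - i) mod N < d}"
  have un: "card (Lvert ` X \<union> Rvert ` X) = 2 * card X" if "finite X" for X
    using that by (subst card_Un_disjoint) (auto simp: card_image inj_on_def)
  have memL: "v \<in> arcL i \<and> bar v \<in> arcL i \<longleftrightarrow> v \<in> Lvert ` ?S 0 (int p) \<union> Rvert ` ?S 0 (int p)"
    "v \<in> arcL i \<and> bar v \<notin> arcL i \<longleftrightarrow> v \<in> Lvert ` ?S (int p) (int (p + s))" for v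
    by (cases v; auto simp: mem_arcs)+
  have "card {v \<in> arcL i. bar v \<in> arcL i} = 2 * card (?S 0 (int p))"
    unfolding memL(1) Collect_mem_eq by (rule un) simp
  moreover have "card {v \<in> arcL i. bar v \<notin> arcL i} = card (?S (int p) (int (p + s)))"
    unfolding memL(2) Collect_mem_eq by (rule card_image) (simp add: inj_on_def)
  moreover have "card (?S 0 (int p)) = p" "card (?S (int p) (int (p + s))) = s"
    using card_arc[of 0 "int p" i] card_arc[of "int p" "int (p + s)" i] n by simp_all
  ultimately show "arcL i \<in> fam"
    unfolding mem_H_family_bar_iff using arcs_subset by simp
  have memR: "v \<in> arcR i \<and> bar v \<in> arcR i \<longleftrightarrow>
      v \<in> Lvert ` ?S (int s) (int (p + s)) \<union> Rvert ` ?S (int s) (int (p + s))"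
    "v \<in> arcR i \<and> bar v \<notin> arcR i \<longleftrightarrow> v \<in> Rvert ` ?S 0 (int s)" for v
    by (cases v; auto simp: mem_arcs)+
  have "card {v \<in> arcR i. bar v \<in> arcR i} = 2 * card (?S (int s) (int (p + s)))"
    unfolding memR(1) Collect_mem_eq by (rule un) simp
  moreover have "card {v \<in> arcR i. bar v \<notin> arcR i} = card (?S 0 (int s))"
    unfolding memR(2) Collect_mem_eq by (rule card_image) (simp add: inj_on_def)
  moreover have "card (?S (int s) (int (p + s))) = p" "card (?S 0 (int s)) = s"
    using card_arc[of 0 "int s" i] card_arc[of "int s" "int (p + s)" i] n by simp_all
  ultimately show "arcR i \<in> fam"
    unfolding mem_H_family_bar_iff using arcs_subset by simp
qed

lemma arcs_periodic: "arcL (i + N) = arcL i" "arcR (i + N) = arcR i"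
proof -
  have "(int m - (i + N)) mod N = (int m - i) mod N" for m
    by (simp add: mod_eq_dvd_iff)
  then show "arcL (i + N) = arcL i" "arcR (i + N) = arcR i"
    unfolding arcL_def arcR_def by (simp_all only:)
qed

text \<open>The two offsets sum to less than \<open>N\<close>, so they add up without wrapping
  around.\<close>

lemma offset_add:
  fixes q i j :: int
  assumes "(q - j) mod N < K" "(j - i) mod N \<le> N - K"
  shows "(q - i) mod N = (q - j) mod N + (j - i) mod N"
proof -
  have "(q - i) mod N = ((q - j) + (j - i)) mod N" by simp
  also have "\<dots> = ((q - j) mod N + (j - i) mod N) mod N" by (rule mod_add_eq[symmetric])
  also have "\<dots> = (q - j) mod N + (j - i) mod N"
    using assms pos_mod_sign[OF n0(2), of "q - j"] pos_mod_sign[OF n0(2), of "j - i"]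
    by (intro mod_pos_pos_trivial) linarith+
  finally show ?thesis .
qed

text \<open>Seen from position \<open>i\<close>, the left vertices of \<open>arcR j\<close> come at
  offset \<open>p + s\<close> or later and its right vertices at offset \<open>p\<close> or later,
  where \<open>arcL i\<close> has ended on the respective side.\<close>

lemma arcs_disjoint:
  assumes "(j - i) mod N \<in> {int p..N - int (p + s)}"
  shows "arcL i \<inter> arcR j = {}"
proof -
  have "\<not> (v \<in> arcL i \<and> v \<in> arcR j)" for v
  proof
    assume v: "v \<in> arcL i \<and> v \<in> arcR j"
    note nn = pos_mod_sign[OF n0(2)] and add = offset_add[of _ j "int (p + s)" i]
    show False
    proof (cases v)
      case (Lvert m)
      then have "(int m - i) mod N < int (p + s)" "int s \<le> (int m - j) mod N"
        "(int m - j) mod N < int (p + s)"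
        using v by (simp_all only: mem_arcs)
      then show False using assms add[of "int m"] by simp
    next
      case (Rvert m)
      then have "(int m - i) mod N < int p" "(int m - j) mod N < int (p + s)"
        using v by (simp_all only: mem_arcs)
      moreover from this have "(int m - i) mod N = (int m - j) mod N + (j - i) mod N"
        using assms by (intro add) simp_all
      ultimately show False using assms nn[of "int m - j"] by (simp only: atLeastAtMost_iff) linarith
    qed
  qed
  then show ?thesis by blast
qed

lemma arcs_self_disjoint:
  assumes "(j - i) mod N \<in> {int (p + s)..N - int (p + s)}"
  shows "arcL i \<inter> arcL j = {}" "arcR i \<inter> arcR j = {}"
proof -
  have "\<not> ((int m - i) mod N < int (p + s) \<and> (int m - j) mod N < int (p + s))" for m
    using assms offset_add[of "int m" j "int (p + s)" i] pos_mod_sign[OF n0(2), of "int m - j"]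
    unfolding atLeastAtMost_iff by linarith
  moreover have "(int (edge_of v) - i) mod N < int (p + s)" if "v \<in> arcL i \<union> arcR i" for v i
    using that by (cases v) (auto simp: mem_arcs)
  ultimately show "arcL i \<inter> arcL j = {}" "arcR i \<inter> arcR j = {}"
    by blast+
qed

lemma autos_disjoint:
  assumes "\<F> \<subseteq> fam" "intersecting_family \<F>" "g \<in> autos n" "g ` X \<in> \<F>" "X \<inter> Y = {}"
  shows "g ` Y \<notin> \<F>"
proof
  assume "g ` Y \<in> \<F>"
  then have "g ` X \<inter> g ` Y \<noteq> {}" by (rule intersecting_familyD[OF assms(2,4)])
  then show False unfolding image_Int[OF autosD(3)[OF assms(3)], symmetric] assms(5) by simp
qed

lemma cyclic_pair_arcs:
  assumes "\<F> \<subseteq> fam" "intersecting_family \<F>" "g \<in> autos n"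
  shows "cyclic_pair N (int p) (int (p + s)) (\<lambda>i. g ` arcL i \<in> \<F>) (\<lambda>i. g ` arcR i \<in> \<F>)"
proof
  show "periodic N (\<lambda>i. g ` arcL i \<in> \<F>)" "periodic N (\<lambda>i. g ` arcR i \<in> \<F>)"
    by (simp_all add: periodic_def arcs_periodic)
  show "(j - i) mod N \<notin> {int p..N - int (p + s)}" if "g ` arcL i \<in> \<F>" "g ` arcR j \<in> \<F>" for i j
    using autos_disjoint[OF assms that(1) arcs_disjoint] that(2) by blast
  show "(j - i) mod N \<notin> {int (p + s)..N - int (p + s)}"
    if "g ` arcL i \<in> \<F>" "g ` arcL j \<in> \<F>" for i j
    using autos_disjoint[OF assms that(1) arcs_self_disjoint(1)] that(2) by blast
  show "(j - i) mod N \<notin> {int (p + s)..N - int (p + s)}"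
    if "g ` arcR i \<in> \<F>" "g ` arcR j \<in> \<F>" for i j
    using autos_disjoint[OF assms that(1) arcs_self_disjoint(2)] that(2) by blast
qed (use p s n in auto)

section \<open>Averaging over the automorphism group\<close>

definition weight :: "vertex set set \<Rightarrow> (vertex \<Rightarrow> vertex) \<Rightarrow> nat" where
  "weight \<F> g = cnt N (\<lambda>i. g ` arcL i \<in> \<F>) + cnt N (\<lambda>i. g ` arcR i \<in> \<F>)"

lemma weight_le:
  assumes "\<F> \<subseteq> fam" "intersecting_family \<F>" "g \<in> autos n"
  shows "weight \<F> g \<le> 2 * p + s"
  using cyclic_pair.cnt_sum_le[OF cyclic_pair_arcs[OF assms]] by (simp add: weight_def)

text \<open>A left vertex lies in \<open>p + s\<close> of the sets \<open>arcL i\<close> and in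
  \<open>p\<close> of the sets \<open>arcR i\<close>, a right vertex the other way round; pulling
  \<open>v\<close> back along \<open>g\<close> reduces to this count.\<close>

lemma weight_star:
  assumes v: "v \<in> M_verts n" and g: "g \<in> autos n"
  shows "weight (star fam v) g = 2 * p + s"
proof -
  define w where "w = inv g v"
  have gw: "g w = v" using g by (simp add: w_def)
  have wM: "w \<in> M_verts n" using v gw autosD(6)[OF g] by metis
  have "g ` X \<in> star fam v \<longleftrightarrow> w \<in> X" if "X \<in> fam" for X
    using that image_H_family[OF g] inj_image_mem_iff[OF autosD(3)[OF g], of w X] gw
    by (simp add: star_def)
  then have weq: "weight (star fam v) g = cnt N (\<lambda>i. w \<in> arcL i) + cnt N (\<lambda>i. w \<in> arcR i)"
    unfolding weight_def by (simp add: arcs_mem_fam)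
  have nn: "0 \<le> z mod N" for z using n0 by simp
  have c: "cnt N (\<lambda>i. c \<le> (q - i) mod N \<and> (q - i) mod N < d) = nat (d - c)"
    if "0 \<le> c" "c \<le> d" "d \<le> N" for c d q
  proof -
    have "periodic N (\<lambda>z. c \<le> (z + q) mod N \<and> (z + q) mod N < d)"
    proof -
      have "(z + N + q) mod N = (z + q) mod N" for z by (simp add: mod_eq_dvd_iff)
      then show ?thesis by (simp add: periodic_def)
    qed
    from cnt_reflect[OF n0(2) this] show ?thesis
      using cnt_interval[OF that, of q] by simp
  qed
  show ?thesis
  proof (cases w)
    case (Lvert m)
    then have "m \<in> {1..n}" using wM by (simp add: mem_M_verts)
    then have "cnt N (\<lambda>i. w \<in> arcL i) = p + s" "cnt N (\<lambda>i. w \<in> arcR i) = p"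
      using c[of 0 "int (p + s)" "int m"] c[of "int s" "int (p + s)" "int m"] Lvert nn n
      by (simp_all add: mem_arcs)
    then show ?thesis using weq by simp
  next
    case (Rvert m)
    then have "m \<in> {1..n}" using wM by (simp add: mem_M_verts)
    then have "cnt N (\<lambda>i. w \<in> arcL i) = p" "cnt N (\<lambda>i. w \<in> arcR i) = p + s"
      using c[of 0 "int (p + s)" "int m"] c[of 0 "int p" "int m"] Rvert nn n
      by (simp_all add: mem_arcs)
    then show ?thesis using weq by simp
  qed
qed

definition stab :: nat where
  "stab = card {g \<in> autos n. g ` arcL 0 = arcL 0}"

lemma stab_pos: "stab > 0"
proof -
  have "id \<in> {g \<in> autos n. g ` arcL 0 = arcL 0}" using id_autos by simp
  then show ?thesis unfolding stab_def card_gt_0_iff using finite_autos by auto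
qed

text \<open>By transitivity every transporter is a two-sided translate of the stabiliser of
  \<open>arcL 0\<close>.\<close>

lemma card_transporter:
  assumes K: "K \<in> fam" and H: "H \<in> fam"
  shows "card {g \<in> autos n. g ` K = H} = stab"
proof -
  obtain a where a: "a \<in> autos n" "a ` K = arcL 0"
    using autos_transitive[OF K arcs_mem_fam(1)] by blast
  obtain b where b: "b \<in> autos n" "b ` arcL 0 = H"
    using autos_transitive[OF arcs_mem_fam(1) H] by blast
  have im: "(x \<circ> y \<circ> z) ` X = x ` y ` z ` X" for x y z :: "vertex \<Rightarrow> vertex" and X
    by (simp add: image_image)
  have "bij_betw (\<lambda>g. b \<circ> g \<circ> a) {g \<in> autos n. g ` arcL 0 = arcL 0} {g \<in> autos n. g ` K = H}"
  proof (rule bij_betw_byWitness[of _ "\<lambda>g. inv b \<circ> g \<circ> inv a"])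
    have "b \<circ> g \<circ> a \<in> autos n" "(b \<circ> g \<circ> a) ` K = H"
      if "g \<in> autos n" "g ` arcL 0 = arcL 0" for g
      by (intro comp_autos a b that) (simp only: im a b that)
    then show "(\<lambda>g. b \<circ> g \<circ> a) ` {g \<in> autos n. g ` arcL 0 = arcL 0} \<subseteq> {g \<in> autos n. g ` K = H}"
      by blast
    have ia: "inv a ` arcL 0 = K" and ib: "inv b ` H = arcL 0"
      unfolding a(2)[symmetric] b(2)[symmetric] by (rule autos_inv_simps(4)[OF a(1)], rule autos_inv_simps(4)[OF b(1)])
    have "inv b \<circ> g \<circ> inv a \<in> autos n" "(inv b \<circ> g \<circ> inv a) ` arcL 0 = arcL 0"
      if "g \<in> autos n" "g ` K = H" for g
      by (intro comp_autos inv_autos a b that) (simp only: im ia ib that)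
    then show "(\<lambda>g. inv b \<circ> g \<circ> inv a) ` {g \<in> autos n. g ` K = H}
        \<subseteq> {g \<in> autos n. g ` arcL 0 = arcL 0}"
      by blast
  qed (use a b in \<open>simp_all add: fun_eq_iff\<close>)
  then show ?thesis unfolding stab_def by (rule bij_betw_same_card[symmetric])
qed

lemma card_orbit:
  assumes "\<F> \<subseteq> fam" "K \<in> fam"
  shows "card {g \<in> autos n. g ` K \<in> \<F>} = card \<F> * stab"
proof -
  have fin: "finite \<F>" using assms(1) finite_H_family finite_subset by blast
  have "{g \<in> autos n. g ` K \<in> \<F>} = (\<Union>H\<in>\<F>. {g \<in> autos n. g ` K = H})" by blast
  also have "card \<dots> = (\<Sum>H\<in>\<F>. card {g \<in> autos n. g ` K = H})"
    by (rule card_UN_disjoint) (use fin finite_autos in auto)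
  also have "\<dots> = (\<Sum>H\<in>\<F>. stab)"
    by (rule sum.cong) (use assms card_transporter in auto)
  finally show ?thesis by simp
qed

text \<open>Double counting: at each of the \<open>n\<close> indices, every member of the family is
  hit by exactly \<open>stab\<close> automorphisms.\<close>

lemma sum_cnt_orbit:
  assumes "\<F> \<subseteq> fam" "\<And>i. K i \<in> fam"
  shows "(\<Sum>g\<in>autos n. cnt N (\<lambda>i. g ` K i \<in> \<F>)) = n * (card \<F> * stab)"
proof -
  let ?I = "\<lambda>g i. if g ` K i \<in> \<F> then 1 else 0 :: nat"
  have c: "card {x \<in> X. P x} = (\<Sum>x\<in>X. if P x then 1 else 0)" if "finite X" for X and P :: "'z \<Rightarrow> bool"
    using that by (simp add: sum.If_cases Int_def)
  have "(\<Sum>g\<in>autos n. cnt N (\<lambda>i. g ` K i \<in> \<F>)) = (\<Sum>g\<in>autos n. \<Sum>i\<in>{0..<N}. ?I g i)"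
    unfolding cnt_def by (simp only: c[OF finite_atLeastLessThan_int])
  also have "\<dots> = (\<Sum>i\<in>{0..<N}. \<Sum>g\<in>autos n. ?I g i)" by (rule sum.swap)
  also have "\<dots> = (\<Sum>i\<in>{0..<N}. card \<F> * stab)"
    by (simp only: c[OF finite_autos, symmetric] card_orbit[OF assms])
  finally show ?thesis by simp
qed

lemma sum_weight:
  assumes "\<F> \<subseteq> fam"
  shows "(\<Sum>g\<in>autos n. weight \<F> g) = 2 * n * stab * card \<F>"
  unfolding weight_def sum.distrib
  by (simp add: sum_cnt_orbit[OF assms arcs_mem_fam(1)] sum_cnt_orbit[OF assms arcs_mem_fam(2)])

lemma card_le_star:
  assumes "\<F> \<subseteq> fam" "intersecting_family \<F>" "v \<in> M_verts n"
  shows "card \<F> \<le> card (star fam v)"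
proof -
  have "star fam v \<subseteq> fam" by (auto simp: star_def)
  then have "2 * n * stab * card (star fam v) = (\<Sum>g\<in>autos n. weight (star fam v) g)"
    by (rule sum_weight[symmetric])
  also have "\<dots> = (\<Sum>g\<in>autos n. 2 * p + s)"
    by (rule sum.cong) (use weight_star[OF assms(3)] in auto)
  also have "\<dots> \<ge> (\<Sum>g\<in>autos n. weight \<F> g)"
    by (rule sum_mono) (rule weight_le[OF assms(1,2)])
  finally have "2 * n * stab * card \<F> \<le> 2 * n * stab * card (star fam v)"
    unfolding sum_weight[OF assms(1)] .
  then show ?thesis using n0 stab_pos by simp
qed

text \<open>The total weights agree and no weight exceeds that of a star, so no single weight can
  fall below it.\<close>

lemma weight_eq:
  assumes "\<F> \<subseteq> fam" "intersecting_family \<F>" "v \<in> M_verts n" "card \<F> = card (star fam v)"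
    and "g \<in> autos n"
  shows "weight \<F> g = 2 * p + s"
proof -
  have st: "star fam v \<subseteq> fam" by (auto simp: star_def)
  have "(\<Sum>g\<in>autos n. weight \<F> g) = (\<Sum>g\<in>autos n. weight (star fam v) g)"
    using assms(4) by (simp add: sum_weight[OF assms(1)] sum_weight[OF st])
  also have "\<dots> = (\<Sum>g\<in>autos n. 2 * p + s)"
    by (rule sum.cong) (use weight_star[OF assms(3)] in auto)
  finally show ?thesis
    by (rule sum_mono_inv[of _ "autos n"]) (use assms weight_le finite_autos in auto)
qed

lemma EKR_fam: "EKR (M_verts n) fam"
proof -
  have "Lvert n \<in> M_verts n" using n0 by (simp add: mem_M_verts)
  then show ?thesis using card_le_star unfolding EKR_def by blast
qed

end

section \<open>Uniqueness of the extremal families\<close>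

lemma swap_image_disjoint:
  assumes "X \<inter> Y = {}"
    and "u \<in> X \<Longrightarrow> w \<notin> Y" "w \<in> X \<Longrightarrow> u \<notin> Y"
    and "bar u \<in> X \<Longrightarrow> bar w \<notin> Y" "bar w \<in> X \<Longrightarrow> bar u \<notin> Y"
  shows "swap u w ` X \<inter> Y = {}"
proof -
  have "swap u w v \<notin> Y" if "v \<in> X" for v
    by (rule swap_cases[where v = v and u = u and w = w])
      (use that assms in \<open>auto simp: swap_other'\<close>)
  then show ?thesis by blast
qed

lemma image_o: "(f \<circ> g) ` X = f ` g ` X"
  by (simp add: image_image)

section \<open>The stabiliser of edge n\<close>

context matching_cycle
begin

abbreviation W :: "vertex set" where
  "W \<equiv> M_verts n - {Lvert n, Rvert n}"

definition pinned :: "(vertex \<Rightarrow> vertex) set" where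
  "pinned = {t \<in> autos n. t (Lvert n) = Lvert n}"

lemma swap_pinned:
  assumes "u \<in> W" "w \<in> W"
  shows "swap u w \<in> pinned"
proof -
  have "Lvert n \<noteq> u" "Lvert n \<noteq> w" "Lvert n \<noteq> bar u" "Lvert n \<noteq> bar w"
    using assms by (cases u; cases w; force)+
  then show ?thesis using assms by (simp add: pinned_def swap_autos swap_other')
qed

lemma W_bar: "v \<in> W \<Longrightarrow> bar v \<in> W"
  by (cases v) (auto simp: mem_M_verts)

lemma W_iff: "v \<in> W \<longleftrightarrow> edge_of v \<in> {1..<n}"
  by (cases v) (auto simp: mem_M_verts)

text \<open>A pinned automorphism also fixes \<open>Rvert n\<close>, so it moves only points of
  \<open>W\<close>, and there the swaps obtained from one hub generate it.\<close>

lemma pinned_in: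
  assumes "id \<in> R" and comp: "\<And>f g. f \<in> R \<Longrightarrow> g \<in> R \<Longrightarrow> f \<circ> g \<in> R"
    and h: "h \<in> W" "swap h (bar h) \<in> R"
    and hub: "\<And>u. u \<in> W \<Longrightarrow> edge_of u \<noteq> edge_of h \<Longrightarrow> swap h u \<in> R \<or> swap h (bar u) \<in> R"
    and t: "t \<in> pinned"
  shows "t \<in> R"
proof -
  have t': "t \<in> autos n" "t (Lvert n) = Lvert n" using t by (simp_all add: pinned_def)
  have "t (Rvert n) = Rvert n"
    using autosD(2)[OF t'(1), of "Lvert n"] t'(2) by simp
  then have fixd: "t v = v" if "v \<notin> W" for v
    using that t'(2) permutes_not_in[OF autosD(1)[OF t'(1)]] by blast
  have WM: "W \<subseteq> M_verts n" by blast
  show ?thesis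
  proof (rule swaps_generate[OF WM W_bar \<open>id \<in> R\<close> comp _ t'(1) fixd])
    show "swap u w \<in> R" if "u \<in> W" "w \<in> W" for u w
      by (rule hub_swaps[OF WM W_bar \<open>id \<in> R\<close> comp h hub that])
  qed
qed

text \<open>Automorphisms agreeing at \<open>Lvert n\<close> lie in one left coset of
  \<open>pinned\<close>. A property stable under right composition with \<open>pinned\<close>
  therefore depends only on the image of \<open>Lvert n\<close>.\<close>

lemma autos_pinned_factor:
  assumes g: "g \<in> autos n" and h: "h \<in> autos n" and eq: "g (Lvert n) = h (Lvert n)"
  obtains t where "t \<in> pinned" "h = g \<circ> t"
proof
  show "inv g \<circ> h \<in> pinned"
    using g h by (simp add: pinned_def comp_autos inv_autos flip: eq)
  show "h = g \<circ> (inv g \<circ> h)"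
    using g by (simp add: fun_eq_iff)
qed

end

section \<open>Families for which every image of the cycle is tight\<close>

locale tight_family = matching_cycle +
  fixes \<F> :: "vertex set set"
  assumes sub: "\<F> \<subseteq> fam" and int: "intersecting_family \<F>" and big: "2 * (p + s) < n"
    and weight: "\<And>g. g \<in> autos n \<Longrightarrow> weight \<F> g = 2 * p + s"
begin

lemma disjoint_notin:
  assumes "g \<in> autos n" "g ` X \<in> \<F>" "X \<inter> Y = {}"
  shows "g ` Y \<notin> \<F>"
  by (rule autos_disjoint[OF sub int assms])

lemma tight:
  assumes "g \<in> autos n"
  shows "cnt N (\<lambda>i. g ` arcL i \<in> \<F>) + cnt N (\<lambda>i. g ` arcR i \<in> \<F>) = nat (int (p + s) + int p)"
  using weight[OF assms] by (simp add: weight_def)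

lemma right_end:
  assumes "g \<in> autos n" "g ` arcL i \<in> \<F>" "g ` arcL (i + 1) \<notin> \<F>"
  shows "g ` arcR (i + 1 - int (p + s)) \<in> \<F>"
  using cyclic_pair.tight_right_end[OF cyclic_pair_arcs[OF sub int assms(1)] tight[OF assms(1)] _ assms(2,3)]
    big by simp

lemma left_end:
  assumes "g \<in> autos n" "g ` arcR i \<in> \<F>" "g ` arcR (i - 1) \<notin> \<F>"
  shows "g ` arcL (i - 1 + int (p + s)) \<in> \<F>"
  using cyclic_pair.tight_left_end[OF cyclic_pair_arcs[OF sub int assms(1)] tight[OF assms(1)] _ assms(2,3)]
    big by simp

lemma mod_arc:
  assumes "0 \<le> x" "x < 2 * N"
  shows "x mod N = (if x < N then x else x - N)"
proof (cases "x < N")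
  case False
  then have "x mod N = (x - N) mod N" by (simp add: mod_eq_dvd_iff)
  also have "\<dots> = x - N" using False assms by (intro mod_pos_pos_trivial) auto
  finally show ?thesis using False by simp
qed (use assms in simp)

text \<open>Replaces residues by linear inequalities between edge labels, so that the effect of
  swaps on the arcs is checked by arithmetic. Edge \<open>n\<close>, at position 0, is treated in
  \<open>mem_arcs_n\<close>.\<close>

lemma mem_arcs_base:
  assumes "m \<in> {1..<n}"
  shows "Lvert m \<in> arcL 0 \<longleftrightarrow> m < p + s" "Rvert m \<in> arcL 0 \<longleftrightarrow> m < p"
    "Lvert m \<in> arcL 1 \<longleftrightarrow> m \<le> p + s" "Rvert m \<in> arcL 1 \<longleftrightarrow> m \<le> p"
    "Lvert m \<in> arcR (1 - int (p + s)) \<longleftrightarrow> m + p \<ge> n + 1"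
    "Rvert m \<in> arcR (1 - int (p + s)) \<longleftrightarrow> m + (p + s) \<ge> n + 1"
    "Lvert m \<in> arcR (- int (p + s)) \<longleftrightarrow> m + p \<ge> n"
    "Rvert m \<in> arcR (- int (p + s)) \<longleftrightarrow> m + (p + s) \<ge> n"
    "Lvert m \<in> arcL (- int p) \<longleftrightarrow> m < s \<or> m + p \<ge> n"
    "Lvert m \<in> arcR 0 \<longleftrightarrow> s \<le> m \<and> m < p + s" "Rvert m \<in> arcR 0 \<longleftrightarrow> m < p + s"
    "Rvert m \<in> arcL (- int p) \<longleftrightarrow> m + p \<ge> n"
proof -
  have m: "m \<in> {1..n}" "1 \<le> m" "m < n" using assms by auto
  have "(int m - 0) mod N = int m" "(int m - 1) mod N = int m - 1"
    using m by (simp_all add: mod_pos_pos_trivial)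
  moreover have "(int m - (1 - int (p + s))) mod N =
      (if int m - (1 - int (p + s)) < N then int m - (1 - int (p + s)) else int m - (1 - int (p + s)) - N)"
    "(int m - (- int (p + s))) mod N =
      (if int m - (- int (p + s)) < N then int m - (- int (p + s)) else int m - (- int (p + s)) - N)"
    "(int m - (- int p)) mod N =
      (if int m - (- int p) < N then int m - (- int p) else int m - (- int p) - N)"
    by (rule mod_arc, use m big in simp, use m big in simp)+
  note mods = calculation this
  show "Lvert m \<in> arcL 0 \<longleftrightarrow> m < p + s" "Rvert m \<in> arcL 0 \<longleftrightarrow> m < p"
    "Lvert m \<in> arcL 1 \<longleftrightarrow> m \<le> p + s" "Rvert m \<in> arcL 1 \<longleftrightarrow> m \<le> p"
    "Lvert m \<in> arcR 0 \<longleftrightarrow> s \<le> m \<and> m < p + s" "Rvert m \<in> arcR 0 \<longleftrightarrow> m < p + s"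
    unfolding mem_arcs mods using m by auto
  show "Lvert m \<in> arcR (1 - int (p + s)) \<longleftrightarrow> m + p \<ge> n + 1"
    "Rvert m \<in> arcR (1 - int (p + s)) \<longleftrightarrow> m + (p + s) \<ge> n + 1"
    "Lvert m \<in> arcR (- int (p + s)) \<longleftrightarrow> m + p \<ge> n"
    "Rvert m \<in> arcR (- int (p + s)) \<longleftrightarrow> m + (p + s) \<ge> n"
    "Lvert m \<in> arcL (- int p) \<longleftrightarrow> m < s \<or> m + p \<ge> n"
    "Rvert m \<in> arcL (- int p) \<longleftrightarrow> m + p \<ge> n"
    unfolding mem_arcs mods using m big by (simp_all split: if_splits) linarith+
qed

lemma mem_arcs_n:
  "Lvert n \<in> arcL 0" "Rvert n \<in> arcL 0"
  "Lvert n \<in> arcL (- int p)" "Rvert n \<notin> arcL (- int p)"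
  "Lvert n \<notin> arcR 0" "Rvert n \<in> arcR 0"
proof -
  have n1: "n \<in> {1..n}" using n0 by simp
  have "(N - 0) mod N = 0" by simp
  moreover have "(N - (- int p)) mod N = int p"
    using big by (simp add: mod_pos_pos_trivial)
  note mods = calculation this
  show "Lvert n \<in> arcL 0" "Rvert n \<in> arcL 0"
    "Lvert n \<in> arcL (- int p)" "Rvert n \<notin> arcL (- int p)"
    "Lvert n \<notin> arcR 0" "Rvert n \<in> arcR 0"
    unfolding mem_arcs mods using n1 p s by simp_all
qed

text \<open>The distances are the two extremes allowed in \<open>arcs_disjoint\<close>:
  \<open>N - (p + s)\<close> for the first two pairs, \<open>p\<close> for the third.\<close>

lemma base_disjoint:
  "arcL 1 \<inter> arcR (1 - int (p + s)) = {}" "arcR (- int (p + s)) \<inter> arcL 0 = {}"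
  "arcR 0 \<inter> arcL (- int p) = {}"
proof -
  have "(- int (p + s)) mod N = N - int (p + s)"
  proof -
    have "(- int (p + s)) mod N = (N - int (p + s)) mod N" by (simp add: mod_eq_dvd_iff)
    also have "\<dots> = N - int (p + s)" using big p by (intro mod_pos_pos_trivial) auto
    finally show ?thesis .
  qed
  then have "(- int (p + s)) mod N \<in> {int p..N - int (p + s)}" using big by simp
  then show "arcL 1 \<inter> arcR (1 - int (p + s)) = {}" "arcR (- int (p + s)) \<inter> arcL 0 = {}"
    using arcs_disjoint[of "1 - int (p + s)" 1] arcs_disjoint[of "- int (p + s)" 0] by auto
  have "(0 - (- int p)) mod N = int p" using big by simp
  then have "(0 - (- int p)) mod N \<in> {int p..N - int (p + s)}" using big by simp
  then show "arcR 0 \<inter> arcL (- int p) = {}"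
    using arcs_disjoint[of 0 "- int p"] by blast
qed

text \<open>The two arcs below meet exactly in the two ends of edge \<open>n\<close>.\<close>

definition meets_at :: "(vertex \<Rightarrow> vertex) \<Rightarrow> bool" where
  "meets_at g \<longleftrightarrow> g ` arcL 0 \<in> \<F> \<and> g ` arcR (1 - int (p + s)) \<in> \<F>"

text \<open>The image of \<open>arcL 1\<close> under the composite misses a member of the family, so
  index 0 is a right end for the composite and \<open>right_end\<close> supplies the second
  arc.\<close>

lemma meets_at_comp1:
  assumes "g \<in> autos n" "t \<in> autos n" "meets_at g"
    and "t ` arcL 0 = arcL 0" "t ` arcL 1 \<inter> arcR (1 - int (p + s)) = {}"
  shows "meets_at (g \<circ> t)"
proof -
  have gt: "g \<circ> t \<in> autos n" by (rule comp_autos[OF assms(1,2)])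
  have 1: "(g \<circ> t) ` arcL 0 \<in> \<F>"
    using assms(3,4) by (simp only: meets_at_def image_o)
  have "g ` (t ` arcL 1) \<notin> \<F>"
    by (rule disjoint_notin[OF assms(1), of "arcR (1 - int (p + s))"])
      (use assms(3,5) in \<open>unfold meets_at_def, blast+\<close>)
  then have "(g \<circ> t) ` arcL (0 + 1) \<notin> \<F>" by (simp only: image_o add_0 not_False_eq_True)
  from right_end[OF gt 1 this] 1 show ?thesis by (simp add: meets_at_def)
qed

text \<open>Mirror image of \<open>meets_at_comp1\<close>: the right arc is kept and
  \<open>left_end\<close> supplies \<open>arcL 0\<close>.\<close>

lemma meets_at_comp2:
  assumes "g \<in> autos n" "t \<in> autos n" "meets_at g"
    and "t ` arcR (1 - int (p + s)) = arcR (1 - int (p + s))"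
    and "t ` arcR (- int (p + s)) \<inter> arcL 0 = {}"
  shows "meets_at (g \<circ> t)"
proof -
  have gt: "g \<circ> t \<in> autos n" by (rule comp_autos[OF assms(1,2)])
  have 1: "(g \<circ> t) ` arcR (1 - int (p + s)) \<in> \<F>"
    using assms(3,4) by (simp only: meets_at_def image_o)
  have "g ` (t ` arcR (- int (p + s))) \<notin> \<F>"
    by (rule disjoint_notin[OF assms(1), of "arcL 0"])
      (use assms(3,5) in \<open>unfold meets_at_def, blast+\<close>)
  moreover have "1 - int (p + s) - 1 = - int (p + s)" by simp
  ultimately have "(g \<circ> t) ` arcR (1 - int (p + s) - 1) \<notin> \<F>"
    by (simp only: image_o not_False_eq_True)
  from left_end[OF gt 1 this] have "(g \<circ> t) ` arcL 0 \<in> \<F>" by simp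
  then show ?thesis using 1 by (simp add: meets_at_def)
qed

text \<open>The automorphisms preserving \<open>meets_at\<close> under right composition are closed
  under composition, so the hub criterion applies. The hub is edge \<open>p + s\<close>, the first
  one after \<open>arcL 0\<close>.\<close>

lemma meets_at_pinned:
  assumes g: "g \<in> autos n" "meets_at g" and t: "t \<in> pinned"
  shows "meets_at (g \<circ> t)"
proof -
  let ?k = "p + s"
  define R where "R = {t \<in> autos n. \<forall>g\<in>autos n. meets_at g \<longrightarrow> meets_at (g \<circ> t)}"
  have comp: "f \<circ> h \<in> R" if "f \<in> R" "h \<in> R" for f h
  proof -
    have "f \<circ> h \<in> autos n" using that comp_autos unfolding R_def by blast
    moreover have "meets_at (g \<circ> (f \<circ> h))" if "g \<in> autos n" "meets_at g" for g
      unfolding comp_assoc[symmetric] using \<open>f \<in> R\<close> \<open>h \<in> R\<close> that comp_autos unfolding R_def by blast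
    ultimately show ?thesis unfolding R_def by blast
  qed
  have id: "id \<in> R" by (simp add: R_def id_autos)
  have V: "Lvert m \<in> M_verts n" "Rvert m \<in> M_verts n" if "m \<in> {1..<n}" for m
    using that by (auto simp: mem_M_verts)
  have k: "?k \<in> {1..<n}" "n - ?k \<in> {1..<n}" using big p by auto
  have rule1: "swap u w \<in> R"
    if "u \<in> M_verts n" "w \<in> M_verts n" "swap u w ` arcL 0 = arcL 0"
      "swap u w ` arcL 1 \<inter> arcR (1 - int ?k) = {}" for u w
    unfolding R_def mem_Collect_eq
    by (intro conjI ballI impI meets_at_comp1 swap_autos that) assumption+
  have rule2: "swap u w \<in> R"
    if "u \<in> M_verts n" "w \<in> M_verts n" "swap u w ` arcR (1 - int ?k) = arcR (1 - int ?k)"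
      "swap u w ` arcR (- int ?k) \<inter> arcL 0 = {}" for u w
    unfolding R_def mem_Collect_eq
    by (intro conjI ballI impI meets_at_comp2 swap_autos that) assumption+
  \<comment> \<open>The hub edge misses \<open>arcL 0\<close> and, because
    \<open>n > 2 * (p + s)\<close>, also \<open>arcR (1 - (p + s))\<close>.\<close>
  have flip: "swap (Lvert ?k) (Rvert ?k) \<in> R"
    by (intro rule1 V k swap_image swap_image_disjoint base_disjoint)
      (use big p s in \<open>simp_all add: mem_arcs_base[OF k(1)] del: of_nat_add\<close>)
  \<comment> \<open>Neither edge meets \<open>arcR (- (p + s))\<close> or
    \<open>arcR (1 - (p + s))\<close>, so the swap fixes both of these arcs.\<close>
  have low: "swap (Lvert ?k) (Lvert a) \<in> R" if "a \<in> {1..<n - ?k}" for a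
  proof -
    have a: "a \<in> {1..<n}" using that by auto
    show ?thesis
      by (intro rule2 V k a swap_image swap_image_disjoint base_disjoint)
        (use big that in \<open>auto simp: mem_arcs_base[OF k(1)] mem_arcs_base[OF a] simp del: of_nat_add\<close>)
  qed
  \<comment> \<open>Edge \<open>n - (p + s)\<close> lies just before
    \<open>arcR (1 - (p + s))\<close> and, like the hub, outside both arcs of
    \<open>meets_at\<close>.\<close>
  have mid: "swap (Lvert ?k) (Lvert (n - ?k)) \<in> R"
    by (intro rule1 V k swap_image swap_image_disjoint base_disjoint)
      (use big p s in \<open>simp_all add: mem_arcs_base[OF k(1)] mem_arcs_base[OF k(2)] del: of_nat_add\<close>)
  \<comment> \<open>By \<open>n > 2 * (p + s)\<close> both edges lie beyond \<open>arcL 1\<close>,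
    which the swap therefore fixes, as it does \<open>arcL 0\<close>.\<close>
  have high: "swap (Lvert (n - ?k)) (Lvert a) \<in> R" if "a \<in> {n - ?k<..<n}" for a
  proof -
    have a: "a \<in> {1..<n}" using that by auto
    show ?thesis
      by (intro rule1 V k a swap_image swap_image_disjoint base_disjoint)
        (use big that in \<open>auto simp: mem_arcs_base[OF k(2)] mem_arcs_base[OF a] simp del: of_nat_add\<close>)
  qed
  have all: "swap (Lvert ?k) (Lvert a) \<in> R" if "a \<in> {1..<n}" "a \<noteq> ?k" for a
  proof -
    have "a \<in> {1..<n - ?k} \<or> a = n - ?k \<or> a \<in> {n - ?k<..<n}"
      using that(1) unfolding atLeastLessThan_iff greaterThanLessThan_iff by linarith
    then consider "a \<in> {1..<n - ?k}" | "a = n - ?k" | "a \<in> {n - ?k<..<n}" by blast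
    then show ?thesis
    proof cases
      case 3
      \<comment> \<open>The edges after \<open>n - (p + s)\<close> are reached from the hub by
        conjugating through edge \<open>n - (p + s)\<close>.\<close>
      have "swap (Lvert ?k) (Lvert (n - ?k)) (Lvert a) = Lvert a"
        by (rule swap_other') (use 3 that in auto)
      with conj_swap_mem[OF comp mid high[OF 3] V(1)[OF k(1)] V(1)[OF k(2)]]
      show ?thesis by simp
    qed (use low mid in auto)
  qed
  have "t \<in> R"
  proof (rule pinned_in[OF id comp _ _ _ t, of "Lvert ?k"])
    show "Lvert ?k \<in> W" using k by (simp only: W_iff edge_of.simps)
    show "swap (Lvert ?k) (bar (Lvert ?k)) \<in> R" using flip by simp
    show "swap (Lvert ?k) u \<in> R \<or> swap (Lvert ?k) (bar u) \<in> R"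
      if "u \<in> W" "edge_of u \<noteq> edge_of (Lvert ?k)" for u
    proof (cases u)
      case (Lvert a)
      then show ?thesis using all[of a] that unfolding W_iff by simp
    next
      case (Rvert a)
      then show ?thesis using all[of a] that unfolding W_iff by simp
    qed
  qed
  then show ?thesis using g unfolding R_def by blast
qed

text \<open>\<open>H\<close> is the image of \<open>arcL 0\<close> under an automorphism agreeing
  with \<open>g\<close> at \<open>Lvert n\<close>, that is, under \<open>g\<close> composed with a
  pinned one, where \<open>meets_at\<close> persists.\<close>

lemma full_edge_mem:
  assumes g: "g \<in> autos n" "meets_at g"
    and H: "H \<in> fam" "g (Lvert n) \<in> H" "bar (g (Lvert n)) \<in> H"
  shows "H \<in> \<F>"
proof -
  have nM: "Lvert n \<in> M_verts n" using n0 by (simp add: mem_M_verts)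
  have "g (Lvert n) \<in> M_verts n" using nM autosD(6)[OF g(1)] by blast
  then obtain h where h: "h \<in> autos n" "h ` arcL 0 = H" "h (Lvert n) = g (Lvert n)"
    using autos_transitive_pinned[OF arcs_mem_fam(1)[of 0] H(1) nM] H mem_arcs_n by auto
  obtain t where t: "t \<in> pinned" "h = g \<circ> t"
    using autos_pinned_factor[OF g(1) h(1) h(3)[symmetric]] by blast
  then show ?thesis using meets_at_pinned[OF g t(1)] h(2) by (simp add: meets_at_def)
qed

text \<open>A member missing the edge would be an image of \<open>arcL (p + s)\<close>, which is
  disjoint from \<open>arcL 0\<close>; the corresponding image of \<open>arcL 0\<close> contains the
  whole edge and so is a member by \<open>full_edge_mem\<close>.\<close>

lemma meets_edge:
  assumes g: "g \<in> autos n" "meets_at g" and K: "K \<in> \<F>"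
  shows "g (Lvert n) \<in> K \<or> bar (g (Lvert n)) \<in> K"
proof (rule ccontr)
  assume neg: "\<not> ?thesis"
  have nM: "Lvert n \<in> M_verts n" using n0 by (simp add: mem_M_verts)
  have gM: "g (Lvert n) \<in> M_verts n" using nM autosD(6)[OF g(1)] by blast
  have km: "int (p + s) mod N = int (p + s)" using big by simp
  have disj: "arcL 0 \<inter> arcL (int (p + s)) = {}"
    by (rule arcs_self_disjoint) (use km big in auto)
  then have "Lvert n \<notin> arcL (int (p + s))" "Rvert n \<notin> arcL (int (p + s))"
    using mem_arcs_n by blast+
  then obtain h where h: "h \<in> autos n" "h ` arcL (int (p + s)) = K" "h (Lvert n) = g (Lvert n)"
    using autos_transitive_pinned[OF arcs_mem_fam(1)[of "int (p + s)"] subsetD[OF sub K] nM gM] neg by auto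
  have "h ` arcL 0 \<in> \<F>"
  proof (rule full_edge_mem[OF g])
    show "h ` arcL 0 \<in> fam" using image_H_family[OF h(1)] arcs_mem_fam by blast
    show "g (Lvert n) \<in> h ` arcL 0" using h(3) mem_arcs_n(1) by (metis imageI)
    show "bar (g (Lvert n)) \<in> h ` arcL 0"
      using h(3) mem_arcs_n(2) autosD(2)[OF h(1), of "Lvert n"] by (metis bar.simps(1) imageI)
  qed
  then show False using disjoint_notin[OF h(1) _ disj] h(2) K by blast
qed

section \<open>Rotations of the cycle\<close>

definition rotate :: "int \<Rightarrow> vertex \<Rightarrow> vertex" where
  "rotate c v = (if v \<in> M_verts n then
     (let m = nat ((int (edge_of v) + c - 1) mod N) + 1 in
       case v of Lvert _ \<Rightarrow> Lvert m | Rvert _ \<Rightarrow> Rvert m) else v)"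

lemma rotate_simps:
  assumes "m \<in> {1..n}"
  shows "rotate c (Lvert m) = Lvert (nat ((int m + c - 1) mod N) + 1)"
    "rotate c (Rvert m) = Rvert (nat ((int m + c - 1) mod N) + 1)"
  using assms by (simp_all add: rotate_def mem_M_verts)

lemma rotate_index:
  defines "f \<equiv> \<lambda>c m. nat ((int m + c - 1) mod N) + 1"
  shows "f c m \<in> {1..n}" "(int (f c m) - (i + c)) mod N = (int m - i) mod N"
    "m \<in> {1..n} \<Longrightarrow> f (- c) (f c m) = m"
proof -
  have nn: "0 \<le> (int m + c - 1) mod N" "(int m + c - 1) mod N < N" for m c using n0 by simp_all
  have i: "int (f c m) = (int m + c - 1) mod N + 1" for c m using nn by (simp add: f_def)
  then have "1 \<le> int (f c m)" "int (f c m) \<le> N" using i[of c m] nn[of m c] by linarith+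
  then show "f c m \<in> {1..n}" by simp
  have "(int (f c m) - (i + c)) mod N = ((int m + c - 1) mod N + (1 - (i + c))) mod N"
    unfolding i by (simp add: algebra_simps)
  also have "\<dots> = (int m + c - 1 + (1 - (i + c))) mod N" by (rule mod_add_left_eq)
  finally show "(int (f c m) - (i + c)) mod N = (int m - i) mod N" by (simp add: algebra_simps)
  assume m: "m \<in> {1..n}"
  have "int (f (- c) (f c m)) = ((int m + c - 1) mod N + 1 + (- c) - 1) mod N + 1"
    unfolding i by simp
  also have "((int m + c - 1) mod N + 1 + (- c) - 1) mod N = ((int m + c - 1) mod N + (- c)) mod N"
    by (simp add: algebra_simps)
  also have "\<dots> = (int m + c - 1 + (- c)) mod N" by (rule mod_add_left_eq)
  also have "\<dots> = int m - 1" using m by (simp add: mod_pos_pos_trivial)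
  finally show "f (- c) (f c m) = m" by simp
qed

lemma rotate_mem [simp]: "rotate c v \<in> M_verts n \<longleftrightarrow> v \<in> M_verts n"
proof (cases "v \<in> M_verts n")
  case True
  then show ?thesis using rotate_index(1)
    by (cases v) (simp_all add: rotate_simps mem_M_verts del: One_nat_def)
qed (simp add: rotate_def)

lemma rotate_rotate: "rotate (- c) (rotate c v) = v"
proof (cases "v \<in> M_verts n")
  case True
  then show ?thesis using rotate_index(1) rotate_index(3)[of _ c]
    by (cases v) (simp_all only: rotate_simps mem_M_verts edge_of.simps)
qed (simp add: rotate_def)

lemma rotate_autos: "rotate c \<in> autos n"
proof -
  have "bij_betw (rotate c) (M_verts n) (M_verts n)"
    by (rule bij_betw_byWitness[of _ "rotate (- c)"])
      (use rotate_rotate[of c] rotate_rotate[of "- c"] in auto)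
  then have "rotate c permutes M_verts n"
    by (rule bij_imp_permutes) (simp add: rotate_def)
  moreover have "rotate c (bar v) = bar (rotate c v)" for v
    by (cases v) (simp_all add: rotate_def Let_def mem_M_verts)
  ultimately show ?thesis by (simp add: autos_def)
qed

lemma rotate_arcs: "rotate c ` arcL i = arcL (i + c)" "rotate c ` arcR i = arcR (i + c)"
proof -
  have mem: "rotate c v \<in> arcL (i + c) \<longleftrightarrow> v \<in> arcL i" "rotate c v \<in> arcR (i + c) \<longleftrightarrow> v \<in> arcR i"
    if "v \<in> M_verts n" for v
    using that rotate_index(1,2)
    by (cases v; simp only: rotate_simps mem_M_verts edge_of.simps mem_arcs)+
  have img: "rotate c ` X = Y"
    if "\<And>v. v \<in> M_verts n \<Longrightarrow> rotate c v \<in> Y \<longleftrightarrow> v \<in> X" "X \<subseteq> M_verts n" "Y \<subseteq> M_verts n" for X Y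
  proof
    show "rotate c ` X \<subseteq> Y" using that(1,2) by blast
    show "Y \<subseteq> rotate c ` X"
    proof
      fix w assume w: "w \<in> Y"
      have eq: "rotate c (rotate (- c) w) = w" using rotate_rotate[of "- c" w] by simp
      have "rotate (- c) w \<in> M_verts n" using w that(3) by auto
      then have "rotate (- c) w \<in> X" using that(1) eq w by metis
      then show "w \<in> rotate c ` X" by (rule rev_image_eqI) (simp only: eq)
    qed
  qed
  show "rotate c ` arcL i = arcL (i + c)"
    by (rule img[OF mem(1) arcs_subset(1) arcs_subset(1)])
  show "rotate c ` arcR i = arcR (i + c)"
    by (rule img[OF mem(2) arcs_subset(2) arcs_subset(2)])
qed

text \<open>The unmoved cycle has a right end at some index \<open>i\<close>; rotating by
  \<open>i\<close> brings it to index 0.\<close>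

lemma meets_at_exists:
  obtains g where "g \<in> autos n" "meets_at g"
proof -
  obtain i where i: "id ` arcL i \<in> \<F>" "id ` arcL (i + 1) \<notin> \<F>"
    using cyclic_pair.tight_boundary_exists[OF cyclic_pair_arcs[OF sub int id_autos] tight[OF id_autos]]
    by blast
  have "id ` arcR (i + 1 - int (p + s)) \<in> \<F>" by (rule right_end[OF id_autos i])
  then have "meets_at (rotate i)"
    using i by (simp add: meets_at_def rotate_arcs algebra_simps)
  then show ?thesis using that rotate_autos by blast
qed

text \<open>All arcs in \<open>\<F>\<close> cover position \<open>0\<close>, and of the disjoint sets \<open>arcL i\<close> and \<open>arcR (i + p)\<close> at
  most one belongs to \<open>\<F>\<close>; the count leaves no slack.\<close>

lemma one_of_pair:
  assumes g: "g \<in> autos n" and meet: "\<And>K. K \<in> \<F> \<Longrightarrow> g (Lvert n) \<in> K \<or> bar (g (Lvert n)) \<in> K"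
  shows "g ` arcL (- int p) \<in> \<F> \<or> g ` arcR 0 \<in> \<F>"
proof -
  let ?A = "\<lambda>i. g ` arcL i \<in> \<F>" and ?B = "\<lambda>i. g ` arcR (i + int p) \<in> \<F>"
  have nM: "n \<in> {1..n}" using n0 by simp
  have perA: "periodic N ?A" by (simp add: periodic_def arcs_periodic)
  have perB: "periodic N (\<lambda>i. g ` arcR i \<in> \<F>)" by (simp add: periodic_def arcs_periodic)
  have cB: "cnt N ?B = cnt N (\<lambda>i. g ` arcR i \<in> \<F>)" by (rule cnt_shift[OF n0(2) perB])
  have "\<not> (?A i \<and> ?B i)" for i
  proof -
    have "(i + int p - i) mod N = int p" using big by simp
    then have "arcL i \<inter> arcR (i + int p) = {}" using big by (intro arcs_disjoint) simp
    then show ?thesis using disjoint_notin[OF g] by blast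
  qed
  then have tot: "cnt N (\<lambda>i. ?A i \<or> ?B i) = 2 * p + s"
    using cnt_disjoint[of ?A ?B N] cB weight[OF g] by (simp add: weight_def)
  have edge: "Lvert n \<in> X \<or> Rvert n \<in> X" if "g ` X \<in> \<F>" for X
    using meet[OF that] autosD(2)[OF g, of "Lvert n"] inj_image_mem_iff[OF autosD(3)[OF g]]
    by (metis bar.simps(1))
  \<comment> \<open>Covering position 0 confines \<open>- i\<close> modulo \<open>N\<close> to this
    window of \<open>2 * p + s\<close> residues: below \<open>p + s\<close> for
    \<open>arcL i\<close>, and from \<open>p\<close> on for \<open>arcR (i + p)\<close>.\<close>
  let ?Z = "\<lambda>i. 0 \<le> (0 - i) mod N \<and> (0 - i) mod N < int (2 * p + s)"
  have N_minus: "(N - i) mod N = (- i) mod N" for i by (simp add: mod_eq_dvd_iff)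
  have A0: "(- i) mod N < int (p + s)" if "?A i" for i
    using edge[OF that] N_minus by (auto simp: mem_arcs)
  have B0: "(- (i + int p)) mod N < int (p + s)" if "?B i" for i
    using edge[OF that] N_minus[of "i + int p"] by (auto simp: mem_arcs)
  have Z: "?Z i" if "?A i \<or> ?B i" for i
    using that
  proof
    assume "?A i"
    then show ?thesis using A0[OF \<open>?A i\<close>] n0 p by simp
  next
    assume "?B i"
    have nn: "0 \<le> (- (i + int p)) mod N" using n0 by simp
    have "(- i) mod N = ((- (i + int p)) + int p) mod N" by simp
    also have "\<dots> = ((- (i + int p)) mod N + int p) mod N" by (rule mod_add_left_eq[symmetric])
    also have "\<dots> = (- (i + int p)) mod N + int p"
      using nn B0[OF \<open>?B i\<close>] big by (intro mod_pos_pos_trivial) auto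
    finally show ?thesis using B0[OF \<open>?B i\<close>] n0 by simp
  qed
  have "cnt N ?Z = 2 * p + s"
  proof -
    have "periodic N (\<lambda>z. 0 \<le> (z + 0) mod N \<and> (z + 0) mod N < int (2 * p + s))"
      by (simp add: periodic_def)
    from cnt_reflect[OF n0(2) this] show ?thesis
      using cnt_interval[of 0 "int (2 * p + s)" 0] big by simp
  qed
  then have eq: "{i \<in> {0..<N}. ?A i \<or> ?B i} = {i \<in> {0..<N}. ?Z i}"
    using tot unfolding cnt_def
    by (intro card_subset_eq finite_cnt_set) (use Z in blast, metis)
  \<comment> \<open>The index \<open>- p\<close>, represented by \<open>N - p\<close>, lies in the
    window. Its pair is \<open>arcL (- p)\<close> and \<open>arcR 0\<close>, which contain opposite
    ends of edge \<open>n\<close>.\<close>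
  have "(0 - (N - int p)) mod N = int p"
  proof -
    have "(0 - (N - int p)) mod N = int p mod N" by (simp add: mod_eq_dvd_iff)
    then show ?thesis using big by simp
  qed
  then have "N - int p \<in> {i \<in> {0..<N}. ?Z i}" using p s big by simp
  then have "?A (N - int p) \<or> ?B (N - int p)" using eq by blast
  moreover have "arcL (N - int p) = arcL (- int p)" "arcR (N - int p + int p) = arcR 0"
    using arcs_periodic(1)[of "- int p"] arcs_periodic(2)[of 0] by (simp_all add: algebra_simps)
  ultimately show ?thesis by simp
qed

section \<open>From a full edge to the star of one end\<close>

text \<open>If \<open>t\<close> keeps \<open>arcR 0\<close> disjoint from \<open>arcL (- p)\<close>,
  the composite cannot put \<open>arcR 0\<close> into the family, so \<open>one_of_pair\<close>
  yields \<open>arcL (- p)\<close>. The hub edge \<open>p + s\<close> meets neither arc, hence every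
  swap with it keeps them disjoint.\<close>

lemma single_vertex_pinned:
  assumes meet: "\<And>K. K \<in> \<F> \<Longrightarrow> v \<in> K \<or> bar v \<in> K"
    and g: "g \<in> autos n" "g (Lvert n) = v" "g ` arcL (- int p) \<in> \<F>" and t: "t \<in> pinned"
  shows "(g \<circ> t) ` arcL (- int p) \<in> \<F>"
proof -
  let ?k = "p + s"
  define P where "P g \<longleftrightarrow> g \<in> autos n \<and> g (Lvert n) = v \<and> g ` arcL (- int p) \<in> \<F>" for g
  define R where "R = {t. \<forall>g. P g \<longrightarrow> P (g \<circ> t)}"
  have comp: "f \<circ> h \<in> R" if "f \<in> R" "h \<in> R" for f h
    using that unfolding R_def mem_Collect_eq comp_assoc[symmetric] by blast
  have id: "id \<in> R" by (simp add: R_def)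
  have step: "t \<in> R" if t: "t \<in> pinned" "t ` arcR 0 \<inter> arcL (- int p) = {}" for t
  proof -
    have "P (g \<circ> t)" if "P g" for g
    proof -
      have ga: "g \<in> autos n" "g (Lvert n) = v" "g ` arcL (- int p) \<in> \<F>"
        using \<open>P g\<close> by (simp_all add: P_def)
      have ta: "t \<in> autos n" "t (Lvert n) = Lvert n" using t(1) by (simp_all add: pinned_def)
      have gt: "g \<circ> t \<in> autos n" "(g \<circ> t) (Lvert n) = v" using comp_autos ga ta by auto
      have "g ` (t ` arcR 0) \<notin> \<F>" by (rule disjoint_notin[OF ga(1,3)]) (use t(2) in blast)
      then have "(g \<circ> t) ` arcL (- int p) \<in> \<F>"
        using one_of_pair[OF gt(1)] meet unfolding gt(2) by (metis image_o)
      then show ?thesis using gt by (simp only: P_def)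
    qed
    then show ?thesis by (simp add: R_def)
  qed
  have k: "?k \<in> {1..<n}" using big p by auto
  have kW: "Lvert ?k \<in> W" "Rvert ?k \<in> W" using k by (simp_all only: W_iff edge_of.simps)
  have "t \<in> R"
  proof (rule pinned_in[OF id comp _ _ _ t, of "Lvert ?k"])
    show "Lvert ?k \<in> W" by (rule kW)
    show "swap (Lvert ?k) (bar (Lvert ?k)) \<in> R"
      unfolding bar.simps
      by (intro step swap_pinned kW swap_image_disjoint base_disjoint)
        (simp_all add: mem_arcs_base[OF k])
    show "swap (Lvert ?k) u \<in> R \<or> swap (Lvert ?k) (bar u) \<in> R"
      if u: "u \<in> W" "edge_of u \<noteq> edge_of (Lvert ?k)" for u
    proof -
      have "swap (Lvert ?k) u \<in> R"
        by (intro step swap_pinned kW u(1) swap_image_disjoint base_disjoint)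
          (use big in \<open>simp_all add: mem_arcs_base[OF k]\<close>)
      then show ?thesis by blast
    qed
  qed
  then show ?thesis using g unfolding R_def P_def by blast
qed

lemma star_subset:
  obtains v where "v \<in> M_verts n" "star fam v \<subseteq> \<F>"
proof -
  have nM: "Lvert n \<in> M_verts n" "Rvert n \<in> M_verts n" using n0 by (simp_all add: mem_M_verts)
  obtain g where g: "g \<in> autos n" "meets_at g" using meets_at_exists by blast
  define u where "u = g (Lvert n)"
  have gR: "g (Rvert n) = bar u" using autosD(2)[OF g(1), of "Lvert n"] by (simp add: u_def)
  have uM: "u \<in> M_verts n" using nM autosD(6)[OF g(1)] by (simp add: u_def)
  have full: "H \<in> \<F>" if "H \<in> fam" "u \<in> H" "bar u \<in> H" for H
    using full_edge_mem[OF g] that by (simp add: u_def)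
  have meet: "u \<in> K \<or> bar u \<in> K" if "K \<in> \<F>" for K
    using meets_edge[OF g that] by (simp add: u_def)
  obtain h v where h: "h \<in> autos n" "h ` arcL (- int p) \<in> \<F>" "h (Lvert n) = v" and v: "v = u \<or> v = bar u"
  proof (cases "g ` arcL (- int p) \<in> \<F>")
    case True
    then show thesis using that[of g u] g by (simp add: u_def)
  next
    case False
    \<comment> \<open>The other set of the pair contains only the end \<open>bar u\<close>, so it is
      an image of \<open>arcL (- p)\<close> with \<open>Lvert n\<close> sent to
      \<open>bar u\<close>, and both cases continue alike.\<close>
    then have R: "g ` arcR 0 \<in> \<F>"
      using one_of_pair[OF g(1)] meet by (simp add: u_def)
    have "bar u \<in> g ` arcR 0" "bar (bar u) \<notin> g ` arcR 0"
      using gR mem_arcs_n(5,6) inj_image_mem_iff[OF autosD(3)[OF g(1)]] u_def by (metis, simp)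
    then obtain h where "h \<in> autos n" "h ` arcL (- int p) = g ` arcR 0" "h (Lvert n) = bar u"
      using autos_transitive_pinned[OF arcs_mem_fam(1)[of "- int p"] subsetD[OF sub R] nM(1), of "bar u"]
        uM mem_arcs_n(3,4) by auto
    then show thesis using that[of h "bar u"] R by simp
  qed
  have vM: "v \<in> M_verts n" using v uM by auto
  have meetv: "v \<in> K \<or> bar v \<in> K" if "K \<in> \<F>" for K using meet[OF that] v by auto
  \<comment> \<open>Sets containing the whole edge are settled by \<open>full\<close>; one
    containing only the end \<open>v\<close> is reached from \<open>h\<close> by a pinned
    automorphism.\<close>
  have "H \<in> \<F>" if H: "H \<in> fam" "v \<in> H" for H
  proof (cases "bar v \<in> H")
    case True
    then show ?thesis using full[OF H(1)] H(2) v by auto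
  next
    case False
    then obtain f where f: "f \<in> autos n" "f ` arcL (- int p) = H" "f (Lvert n) = v"
      using autos_transitive_pinned[OF arcs_mem_fam(1)[of "- int p"] H(1) nM(1) vM] H(2) mem_arcs_n(3,4)
      by auto
    obtain t where t: "t \<in> pinned" "f = h \<circ> t"
      using autos_pinned_factor[OF h(1) f(1)] h(3) f(3) by metis
    have "(h \<circ> t) ` arcL (- int p) \<in> \<F>"
      by (rule single_vertex_pinned[OF meetv h(1,3,2) t(1)])
    then show ?thesis using t(2) f(2) by simp
  qed
  then have "star fam v \<subseteq> \<F>" by (auto simp: star_def)
  then show thesis using that vM by blast
qed

end

lemma (in matching_cycle) strongly_EKR_fam:
  assumes big: "2 * (p + s) < n"
  shows "strongly_EKR (M_verts n) fam"
  unfolding strongly_EKR_def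
proof (intro allI impI)
  fix \<F> assume "max_intersecting_subfamily fam \<F>"
  then have F: "\<F> \<subseteq> fam" "intersecting_family \<F>"
    and max: "\<And>\<G>. \<G> \<subseteq> fam \<Longrightarrow> intersecting_family \<G> \<Longrightarrow> card \<G> \<le> card \<F>"
    unfolding max_intersecting_subfamily_def by blast+
  have st: "star fam v \<subseteq> fam" for v by (auto simp: star_def)
  \<comment> \<open>Every star is a maximum family. Tightness can thus be obtained from
    \<open>Lvert n\<close>, and the final comparison made at the vertex found afterwards.\<close>
  have eq: "card \<F> = card (star fam v)" if "v \<in> M_verts n" for v
    by (rule antisym[OF card_le_star[OF F that] max[OF st intersecting_star]])
  have nM: "Lvert n \<in> M_verts n" using n0 by (simp add: mem_M_verts)
  interpret tight_family p s n \<F>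
    by unfold_locales (use F big weight_eq[OF F nM eq[OF nM]] in auto)
  obtain v where v: "v \<in> M_verts n" "star fam v \<subseteq> \<F>" using star_subset by blast
  have "finite \<F>" using F(1) finite_H_family finite_subset by blast
  then have "star fam v = \<F>" using v(2) eq[OF v(1)] by (simp add: card_subset_eq)
  then show "\<exists>x\<in>M_verts n. \<F> = star fam x" using v(1) by blast
qed

theorem theorem2:
  fixes p s n :: nat
  assumes "s \<ge> 1" and "p \<ge> 1" and "n \<ge> 2 * (p + s)"
  shows "EKR (M_verts n) (H_family p s n) \<and>
         (n > 2 * (p + s) \<longrightarrow> strongly_EKR (M_verts n) (H_family p s n))"
proof -
  interpret matching_cycle p s n by unfold_locales (use assms in auto)
  show ?thesis using EKR_fam strongly_EKR_fam by blast
qed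

end
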